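(* For every $j\ge1$, the $j$th lower-diagonal magnitude $d_j=x_j^L-y_j^L$ satisfies $|d_j-j|\le 4$.
   Context: $\mathbb N=\{0,1,2,\dots\}$. The greedy queens sequence $(q_n)_{n\ge0}$ is defined by $q_0=0$ and, for $n\ge1$, $q_n$ is the least $y\in\mathbb N$ such that for all $0\le i<n$: $y\ne q_i$, $y-n\ne q_i-i$, and $y+n\ne q_i+i$. The queen in column $n$ is the square $(n,q_n)$; it is called lower if $q_n<n$. There are infinitely many lower queens; list them in order of increasing column as $(x_1^L,y_1^L),(x_2^L,y_2^L),\dots$, so $x_1^L<x_2^L<\cdots$ and $y_j^L=q_{x_j^L}$. *)

theory Defs
  imports Complex_Main "HOL-Library.Infinite_Set"
begin

text \<open>Diagonals are compared in \<open>int\<close>, since subtraction on \<open>nat\<close> truncates.\<close>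

fun queen :: "nat \<Rightarrow> nat" where
  "queen n =
    (if n = 0 then 0
     else (LEAST y. \<forall>i<n. y \<noteq> queen i
                      \<and> int y - int n \<noteq> int (queen i) - int i
                      \<and> y + n \<noteq> queen i + i))"

declare queen.simps [simp del]

definition lower_columns :: "nat set" where
  "lower_columns = {n. queen n < n}"

text \<open>
  Lower queens are numbered from 1, whereas \<open>enumerate\<close> numbers from 0.
  The value at index 0 has no meaning. \<open>enumerate\<close> lists \<open>lower_columns\<close>
  in increasing order because that set is infinite.
\<close>

definition lower_x :: "nat \<Rightarrow> nat" where
  "lower_x j = enumerate lower_columns (j - 1)"

definition lower_y :: "nat \<Rightarrow> nat" where
  "lower_y j = queen (lower_x j)"

definition lower_diag :: "nat \<Rightarrow> int" where
  "lower_diag j = int (lower_x j) - int (lower_y j)"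

end

theory Submission
  imports Defs
begin

text \<open>
  Why the theorem holds. Call a column \<open>n\<close> upper if \<open>queen n > n\<close> and lower if \<open>queen n < n\<close>. Upper
  queens are completely regular: the \<open>k\<close>-th one, in column \<open>x\<close>, stands in row \<open>x + k\<close>, because the
  first \<open>k - 1\<close> upper diagonals are used up and everything beyond is still clear
  (\<open>greedy_choice\<close>). A column is lower exactly if some square below the main diagonal is free, and
  then its queen takes the lowest such square.

  So everything that can happen in column \<open>n\<close> is decided near the lowest row \<open>a\<close> that is still
  free. A square \<open>(n, a + i)\<close> can be blocked by earlier lower queens, of which only the last few
  matter, and by upper queens in two ways. The row \<open>a + i\<close> may hold an upper queen, or the
  antidiagonal may: an upper queen \<open>(x, y)\<close> with \<open>x + y = n + a + i\<close>. As the lower queens lie close to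
  the mirror image of the upper ones, such a queen has \<open>x\<close> close to \<open>a\<close> and \<open>y\<close> close to \<open>n\<close>. Hence
  both kinds of blocking can be read off from one word, the tape, whose letter at \<open>z\<close> tells whether
  column \<open>z\<close> is upper and whether row \<open>z\<close> holds an upper queen. The letter at \<open>n\<close> depends, through a
  bounded amount of memory, on the letters around position \<open>a\<close>, which is about \<open>n\<close> divided by the
  golden ratio. The sequence is thus the fixed point of a transducer that reads its own output.

  Fed with an arbitrary word, the transducer can exceed the bound of the theorem; words that it has
  itself produced are tame. The proof therefore exhibits a regular superset of the possible tapes,
  given by a finite automaton. Induction on the column shows that, from column 30 on, reading a
  word of this set makes the transducer visit only 160 memory states, write a word of this
  set, and keep the deviation of every lower queen at most 4. The induction closes because the
  reading head is always behind the writing head.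

  The memory states are made precise by \<open>view\<close>, and \<open>read_sound\<close> and \<open>step_sound\<close> say that the
  executable transducer follows the queens. The induction hypothesis is \<open>linked\<close>: it
  relates the automaton state at the reading head, the memory state, and the automaton state at the
  writing head. The admissible triples are listed explicitly, and
  \<open>views_checked\<close> and \<open>links_checked\<close> verify by rewriting that the list is closed.
\<close>

section \<open>Upper and lower columns\<close>

definition upper :: "nat \<Rightarrow> bool" where
  "upper n \<longleftrightarrow> n < queen n"

definition lower :: "nat \<Rightarrow> bool" where
  "lower n \<longleftrightarrow> queen n < n"

definition uppers_below :: "nat \<Rightarrow> nat" where
  "uppers_below n = card {k. k < n \<and> upper k}"

definition lowers_below :: "nat \<Rightarrow> nat" where
  "lowers_below n = card {k. k < n \<and> lower k}"

definition free_square :: "nat \<Rightarrow> nat \<Rightarrow> bool" where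
  "free_square n y \<longleftrightarrow> (\<forall>i<n. y \<noteq> queen i \<and> int y - int n \<noteq> int (queen i) - int i \<and> y + n \<noteq> queen i + i)"

lemma queen_0 [simp]: "queen 0 = 0"
  by (simp add: queen.simps)

lemma not_upper_0 [simp]: "\<not> upper 0"
  by (simp add: upper_def)

lemma not_lower_0 [simp]: "\<not> lower 0"
  by (simp add: lower_def)

lemma queen_Least:
  assumes "0 < n"
  shows "queen n = (LEAST y. free_square n y)"
  using assms by (subst queen.simps) (simp add: free_square_def[abs_def])

lemma uppers_below_Suc: "uppers_below (Suc n) = uppers_below n + (if upper n then 1 else 0)"
proof -
  have "{k. k < Suc n \<and> upper k} = {k. k < n \<and> upper k} \<union> (if upper n then {n} else {})"
    by (auto simp: less_Suc_eq)
  then show ?thesis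
    unfolding uppers_below_def by (auto simp: card_insert_if)
qed

lemma uppers_below_mono: "m \<le> n \<Longrightarrow> uppers_below m \<le> uppers_below n"
  unfolding uppers_below_def by (rule card_mono) auto

lemma uppers_below_attains:
  "d < uppers_below n \<Longrightarrow> \<exists>i<n. upper i \<and> uppers_below i = d"
proof (induction n)
  case 0
  then show ?case by (simp add: uppers_below_def)
next
  case (Suc n)
  show ?case
  proof (cases "d < uppers_below n")
    case True
    with Suc.IH show ?thesis using less_SucI by blast
  next
    case False
    with Suc.prems have "upper n" "uppers_below n = d"
      by (auto simp: uppers_below_Suc split: if_splits)
    then show ?thesis by blast
  qed
qed

text \<open>
  The square \<open>Y\<close> on the first upper diagonal that no upper queen uses is always free: its row
  and its antidiagonal lie beyond those of all earlier queens. Every square of the column between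
  the main diagonal and \<open>Y\<close> is on a used diagonal. So only the squares below the main diagonal can
  compete with \<open>Y\<close>.
\<close>
lemma greedy_choice:
  assumes "0 < n"
  shows "(if \<exists>y<n. free_square n y then queen n < n
          else queen n = n + uppers_below n + 1)"
  using assms
proof (induction n rule: less_induct)
  case (less n)
  have up: "queen i = i + uppers_below i + 1" if "upper i" "i < n" for i
  proof -
    have "0 < i" using that by (cases i) auto
    from less.IH[OF that(2) this] that(1) show ?thesis
      by (auto simp: upper_def split: if_splits)
  qed
  let ?Y = "n + uppers_below n + 1"
  have "free_square n ?Y"
    unfolding free_square_def
  proof (intro allI impI)
    fix i assume "i < n"
    show "?Y \<noteq> queen i \<and> int ?Y - int n \<noteq> int (queen i) - int i \<and> ?Y + n \<noteq> queen i + i"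
    proof (cases "upper i")
      case True
      have "uppers_below i < uppers_below n"
        using uppers_below_mono[of "Suc i" n] True \<open>i < n\<close> by (simp add: uppers_below_Suc)
      then show ?thesis using up[OF True \<open>i < n\<close>] \<open>i < n\<close> by auto
    next
      case False
      then have "queen i \<le> i"
        by (auto simp: upper_def)
      then show ?thesis using \<open>i < n\<close> by auto
    qed
  qed
  then have le: "queen n \<le> ?Y" and fr: "free_square n (queen n)"
    unfolding queen_Least[OF less.prems] by (rule Least_le, rule LeastI)
  show ?case
  proof (cases "\<exists>y<n. free_square n y")
    case True
    then obtain y where "y < n" "free_square n y" by blast
    then have "queen n \<le> y" unfolding queen_Least[OF less.prems] by (intro Least_le)
    with True \<open>y < n\<close> show ?thesis by auto
  next
    case False
    with fr have "n \<le> queen n" by (meson not_le)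
    moreover have "queen n \<noteq> n + d" if "d \<le> uppers_below n" for d
    proof (cases d)
      case 0
      (* the main diagonal is blocked by the queen in the corner *)
      then show ?thesis using fr less.prems unfolding free_square_def by force
    next
      case (Suc d')
      with that obtain i where i: "i < n" "upper i" "uppers_below i = d'"
        using uppers_below_attains[of d' n] by auto
      then show ?thesis using up[of i] Suc fr unfolding free_square_def by force
    qed
    ultimately have "queen n = ?Y"
      using le by (metis add.assoc le_Suc_eq le_add_diff_inverse nat_add_left_cancel_le plus_1_eq_Suc add.commute)
    with False show ?thesis by simp
  qed
qed

lemma lower_iff_free: "0 < n \<Longrightarrow> lower n \<longleftrightarrow> (\<exists>y<n. free_square n y)"
  using greedy_choice[of n] by (auto simp: lower_def split: if_splits)

lemma upper_iff_not_lower: "0 < n \<Longrightarrow> upper n \<longleftrightarrow> \<not> lower n"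
  using greedy_choice[of n] by (auto simp: lower_def upper_def split: if_splits)

lemma queen_upper: "upper n \<Longrightarrow> queen n = n + uppers_below n + 1"
  using greedy_choice[of n] by (cases n) (auto simp: upper_def split: if_splits)

lemma queen_le_free:
  assumes "0 < n" "free_square n y"
  shows "queen n \<le> y"
  using assms by (simp add: queen_Least Least_le)

lemma queen_free:
  assumes n: "0 < n"
  shows "free_square n (queen n)"
proof -
  define Y where "Y = Max (insert 0 ((\<lambda>i. queen i + i) ` {..<n})) + n + 1"
  have "free_square n Y"
    unfolding free_square_def
  proof (intro allI impI)
    fix i assume "i < n"
    then have "queen i + i \<le> Max (insert 0 ((\<lambda>i. queen i + i) ` {..<n}))"
      by (intro Max_ge) auto
    then show "Y \<noteq> queen i \<and> int Y - int n \<noteq> int (queen i) - int i \<and> Y + n \<noteq> queen i + i"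
      unfolding Y_def by linarith
  qed
  then show ?thesis unfolding queen_Least[OF n] by (rule LeastI)
qed

section \<open>Occupied rows and diagonals\<close>

definition upper_rows :: "int set" where
  "upper_rows = {int (queen k) | k. upper k}"

definition upper_antis :: "int set" where
  "upper_antis = {int k + int (queen k) | k. upper k}"

definition lower_rows :: "nat \<Rightarrow> int set" where
  "lower_rows n = {int (queen k) | k. k < n \<and> lower k}"

definition lower_diags :: "nat \<Rightarrow> int set" where
  "lower_diags n = {int k - int (queen k) | k. k < n \<and> lower k}"

definition lower_antis :: "nat \<Rightarrow> int set" where
  "lower_antis n = {int k + int (queen k) | k. k < n \<and> lower k}"

lemma lower_sets_Suc:
  "lower_rows (Suc n) = (if lower n then insert (int (queen n)) (lower_rows n) else lower_rows n)"
  "lower_diags (Suc n) = (if lower n then insert (int n - int (queen n)) (lower_diags n) else lower_diags n)"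
  "lower_antis (Suc n) = (if lower n then insert (int n + int (queen n)) (lower_antis n) else lower_antis n)"
  unfolding lower_rows_def lower_diags_def lower_antis_def by (auto simp: less_Suc_eq)

text \<open>
  Below the main diagonal the upper queens can be taken from the whole infinite board: an upper queen
  whose row or antidiagonal meets column \<open>n\<close> below the main diagonal stands to the left of that column.
  This makes the effect of the upper queens independent of the column.
\<close>
lemma free_square_iff:
  assumes "y < n"
  shows "free_square n y \<longleftrightarrow> 0 < y \<and> int y \<notin> upper_rows \<and> int y \<notin> lower_rows n
    \<and> int n - int y \<notin> lower_diags n \<and> int n + int y \<notin> upper_antis \<and> int n + int y \<notin> lower_antis n"
    (is "_ \<longleftrightarrow> ?R")
proof
  assume F: "free_square n y"
  have "0 < y" using F assms by (auto simp: free_square_def dest!: spec[of _ 0])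
  moreover have "int y \<notin> upper_rows"
  proof
    assume "int y \<in> upper_rows"
    then obtain k where "upper k" "y = queen k" by (auto simp: upper_rows_def)
    moreover from this have "k < n" using assms by (simp add: upper_def)
    ultimately show False using F by (auto simp: free_square_def)
  qed
  moreover have "int n + int y \<notin> upper_antis"
  proof
    assume "int n + int y \<in> upper_antis"
    then obtain k where "upper k" "n + y = k + queen k" by (auto simp: upper_antis_def)
    moreover from this have "k < n" using assms by (simp add: upper_def)
    ultimately show False using F by (auto simp: free_square_def)
  qed
  moreover have "int y \<notin> lower_rows n" "int n - int y \<notin> lower_diags n" "int n + int y \<notin> lower_antis n"
    using F by (force simp: free_square_def lower_rows_def lower_diags_def lower_antis_def)+
  ultimately show ?R by blast
next
  assume R: ?R
  show "free_square n y"
    unfolding free_square_def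
  proof (intro allI impI)
    fix i assume i: "i < n"
    consider "i = 0" | "upper i" | "lower i"
      using upper_iff_not_lower[of i] by blast
    then show "y \<noteq> queen i \<and> int y - int n \<noteq> int (queen i) - int i \<and> y + n \<noteq> queen i + i"
    proof cases
      case 1
      then show ?thesis using R assms by auto
    next
      case 2
      then have "int (queen i) \<in> upper_rows" "int i + int (queen i) \<in> upper_antis" "i < queen i"
        by (auto simp: upper_rows_def upper_antis_def upper_def)
      then have "int y \<noteq> int (queen i)" "int n + int y \<noteq> int i + int (queen i)" "i < queen i"
        using R by metis+
      then show ?thesis using assms by (intro conjI) linarith+
    next
      case 3
      then have "int (queen i) \<in> lower_rows n" "int i - int (queen i) \<in> lower_diags n"
        "int i + int (queen i) \<in> lower_antis n"
        using i by (auto simp: lower_rows_def lower_diags_def lower_antis_def)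
      then have "int y \<noteq> int (queen i)" "int n - int y \<noteq> int i - int (queen i)"
        "int n + int y \<noteq> int i + int (queen i)"
        using R by metis+
      then show ?thesis by (intro conjI) linarith+
    qed
  qed
qed

lemma card_lower_diags: "card (lower_diags n) = lowers_below n"
proof -
  have "inj_on (\<lambda>k. int k - int (queen k)) {k. k < n \<and> lower k}"
  proof (rule linorder_inj_onI)
    fix x y assume xy: "x < y" "x \<in> {k. k < n \<and> lower k}" "y \<in> {k. k < n \<and> lower k}"
    then have "free_square y (queen y)" using queen_free[of y] by simp
    then show "int x - int (queen x) \<noteq> int y - int (queen y)"
      using xy by (auto simp: free_square_def)
  qed auto
  moreover have "lower_diags n = (\<lambda>k. int k - int (queen k)) ` {k. k < n \<and> lower k}"
    by (auto simp: lower_diags_def)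
  ultimately show ?thesis
    unfolding lowers_below_def by (simp add: card_image)
qed

section \<open>The board seen from the lowest free row\<close>

text \<open>The first letter is for the column, the second for the row: U for upper, L for lower.\<close>
datatype letter = UU | UL | LU | LL

fun mk_letter :: "bool \<Rightarrow> bool \<Rightarrow> letter" where
  "mk_letter True True = UU"
| "mk_letter True False = UL"
| "mk_letter False True = LU"
| "mk_letter False False = LL"

definition letter :: "nat \<Rightarrow> letter" where
  "letter z = mk_letter (upper z) (int z \<in> upper_rows)"

datatype state = State
  (lead: int) (diags: "int list") (rows: "int list") (antis: "int list") (uppers: "int list")
  (horizon: int) (excess: int)

text \<open>
  A state is the memory of the transducer when column \<open>n\<close> is about to be filled and the letters
  before position \<open>r\<close> have been read. All numbers in it are relative, which is why finitely many states
  suffice. Rows are counted from a row \<open>a\<close> with everything below it occupied, and antidiagonals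
  from the one of the square \<open>(n, a)\<close>. Lower diagonals are counted from \<open>M = n - a + lead\<close>, with
  everything below \<open>M\<close> used; so the square \<open>(n, a + i)\<close> has diagonal \<open>M\<close> plus \<open>- lead - i\<close>. The list
  \<open>uppers\<close> holds the rows of upper queens, counted from row \<open>n\<close>; it predicts the second half of the
  letter that will be written at \<open>n\<close>. An upper queen in column \<open>r\<close> or later has row at least
  \<open>n + excess + 1\<close>, so \<open>uppers\<close> is complete up to \<open>excess\<close>, and \<open>antis\<close> up to \<open>horizon + excess\<close>.

  The sets \<open>LR\<close>, \<open>LD\<close> and \<open>LA\<close> stand for the rows, diagonals and antidiagonals of the lower queens.
  They are parameters because placing a queen and moving on to the next column are treated separately.
\<close>
locale view =
  fixes n :: nat and LR LD LA :: "int set" and a :: int and r :: nat and s :: state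
  assumes a_pos: "0 < a"
    and below_a: "\<lbrakk>0 < y; y < a\<rbrakk> \<Longrightarrow> y \<in> upper_rows \<union> LR"
    and horizon: "horizon s = int r - a"
    and excess: "excess s = int r + int (uppers_below r) - int n"
    and rows: "i \<in> set (rows s) \<longleftrightarrow> 0 \<le> i \<and> (a + i \<in> LR \<or> i < horizon s \<and> a + i \<in> upper_rows)"
    and antis: "i \<in> set (antis s) \<longleftrightarrow> 0 \<le> i \<and> (int n + a + i \<in> LA
          \<or> (\<exists>k<r. upper k \<and> int n + a + i = int k + int (queen k)))"
    and uppers: "i \<in> set (uppers s) \<longleftrightarrow> 0 \<le> i \<and> (\<exists>k<r. upper k \<and> int n + i = int (queen k))"
    and M_pos: "0 < int n - a + lead s"
    and below_M: "\<lbrakk>0 < d; d < int n - a + lead s\<rbrakk> \<Longrightarrow> d \<in> LD"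
    and diags: "i \<in> set (diags s) \<longleftrightarrow> 0 \<le> i \<and> int n - a + lead s + i \<in> LD"
    and distinct_diags: "distinct (diags s)"

abbreviation view_at :: "nat \<Rightarrow> int \<Rightarrow> nat \<Rightarrow> state \<Rightarrow> bool" where
  "view_at n \<equiv> view n (lower_rows n) (lower_diags n) (lower_antis n)"

fun ins :: "int \<Rightarrow> int list \<Rightarrow> int list" where
  "ins x [] = [x]"
| "ins x (y # ys) = (if x < y then x # y # ys else if x = y then y # ys else y # ins x ys)"

lemma set_ins [simp]: "set (ins x ys) = insert x (set ys)"
  by (induction x ys rule: ins.induct) auto

lemma distinct_ins: "distinct ys \<Longrightarrow> x \<notin> set ys \<Longrightarrow> distinct (ins x ys)"
  by (induction x ys rule: ins.induct) auto

definition ins_nonneg :: "int \<Rightarrow> int list \<Rightarrow> int list" where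
  "ins_nonneg x xs = (if x < 0 then xs else ins x xs)"

lemma set_ins_nonneg: "i \<in> set (ins_nonneg x xs) \<longleftrightarrow> (i = x \<and> 0 \<le> x) \<or> i \<in> set xs"
  by (auto simp: ins_nonneg_def)

definition shift :: "int \<Rightarrow> int list \<Rightarrow> int list" where
  "shift t xs = map (\<lambda>x. x - t) (filter (\<lambda>x. t \<le> x) xs)"

lemma set_shift: "i \<in> set (shift t xs) \<longleftrightarrow> 0 \<le> i \<and> i + t \<in> set xs"
proof
  assume "0 \<le> i \<and> i + t \<in> set xs"
  then show "i \<in> set (shift t xs)"
    unfolding shift_def by (auto intro!: image_eqI[of _ _ "i + t"])
qed (auto simp: shift_def)

lemma distinct_shift: "distinct xs \<Longrightarrow> distinct (shift t xs)"
  by (auto simp: shift_def distinct_map inj_on_def)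

text \<open>
  On a sorted list this is the least number from \<open>t\<close> on that is missing; on any list, everything
  skipped is present, which is all that the soundness of the transducer requires.
\<close>
fun gap :: "int \<Rightarrow> int list \<Rightarrow> int" where
  "gap t [] = t"
| "gap t (x # xs) = (if x = t then gap (t + 1) xs else t)"

lemma gap_filled: "t \<le> i \<Longrightarrow> i < gap t xs \<Longrightarrow> i \<in> set xs"
proof (induction t xs rule: gap.induct)
  case (2 t x xs)
  then show ?case by (cases "i = t") (auto split: if_splits)
qed simp

lemma gap_ge: "t \<le> gap t xs"
proof (induction t xs rule: gap.induct)
  case (2 t x xs)
  then show ?case by (cases "x = t") auto
qed simp

section \<open>Reading a letter\<close>

text \<open>
  If column \<open>r\<close> is upper, its queen stands in row \<open>r + uppers_below r + 1 = n + e + 1\<close> and therefore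
  on the antidiagonal \<open>h + e + 1\<close> above that of \<open>(n, a)\<close>. Negative offsets are dropped: they only
  get smaller from column to column.
\<close>
fun read :: "letter \<Rightarrow> state \<Rightarrow> state" where
  "read UU (State m D R A Y h e) =
     State m D (ins_nonneg h R) (ins_nonneg (h + e + 1) A) (ins_nonneg (e + 1) Y) (h + 1) (e + 2)"
| "read UL (State m D R A Y h e) =
     State m D R (ins_nonneg (h + e + 1) A) (ins_nonneg (e + 1) Y) (h + 1) (e + 2)"
| "read LU (State m D R A Y h e) = State m D (ins_nonneg h R) A Y (h + 1) (e + 1)"
| "read LL (State m D R A Y h e) = State m D R A Y (h + 1) (e + 1)"

lemma read_sound:
  assumes "view n LR LD LA a r s"
  shows "view n LR LD LA a (Suc r) (read (letter r) s)"
proof -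
  obtain m D R A Y h e where s: "s = State m D R A Y h e" by (cases s)
  note V = assms[unfolded s]
  note h = view.horizon[OF V, unfolded state.sel] and e = view.excess[OF V, unfolded state.sel]
    and R = view.rows[OF V, unfolded state.sel] and A = view.antis[OF V, unfolded state.sel]
    and Y = view.uppers[OF V, unfolded state.sel]
  have R1: "i \<in> set (ins_nonneg h R) \<longleftrightarrow> 0 \<le> i \<and> (a + i \<in> LR \<or> i < h + 1 \<and> a + i \<in> upper_rows)"
    if "int r \<in> upper_rows" for i
    unfolding set_ins_nonneg R using that h by (cases "i = h") auto
  have R2: "i \<in> set R \<longleftrightarrow> 0 \<le> i \<and> (a + i \<in> LR \<or> i < h + 1 \<and> a + i \<in> upper_rows)"
    if "int r \<notin> upper_rows" for i
    unfolding R using that h by (cases "i = h") auto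
  have q: "int (queen r) = int n + e + 1" if "upper r"
    using queen_upper[OF that] e by simp
  have A1: "i \<in> set (ins_nonneg (h + e + 1) A) \<longleftrightarrow> 0 \<le> i \<and> (int n + a + i \<in> LA
          \<or> (\<exists>k<Suc r. upper k \<and> int n + a + i = int k + int (queen k)))" if "upper r" for i
    unfolding set_ins_nonneg A using q[OF that] that h by (auto simp: less_Suc_eq)
  have A2: "i \<in> set A \<longleftrightarrow> 0 \<le> i \<and> (int n + a + i \<in> LA
          \<or> (\<exists>k<Suc r. upper k \<and> int n + a + i = int k + int (queen k)))" if "\<not> upper r" for i
    unfolding A using that by (auto simp: less_Suc_eq)
  have Y1: "i \<in> set (ins_nonneg (e + 1) Y) \<longleftrightarrow> 0 \<le> i \<and> (\<exists>k<Suc r. upper k \<and> int n + i = int (queen k))"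
    if "upper r" for i
    unfolding set_ins_nonneg Y using q[OF that] that by (auto simp: less_Suc_eq)
  have Y2: "i \<in> set Y \<longleftrightarrow> 0 \<le> i \<and> (\<exists>k<Suc r. upper k \<and> int n + i = int (queen k))"
    if "\<not> upper r" for i
    unfolding Y using that by (auto simp: less_Suc_eq)
  have e2: "e + 2 = int (Suc r) + int (uppers_below (Suc r)) - int n" if "upper r"
    using that e by (simp add: uppers_below_Suc)
  have e1: "e + 1 = int (Suc r) + int (uppers_below (Suc r)) - int n" if "\<not> upper r"
    using that e by (simp add: uppers_below_Suc)
  have h1: "h + 1 = int (Suc r) - a" using h by simp
  have goal: "view n LR LD LA a (Suc r) (State m D R' A' Y' (h + 1) e')"
    if "e' = int (Suc r) + int (uppers_below (Suc r)) - int n"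
      "\<And>i. i \<in> set R' \<longleftrightarrow> 0 \<le> i \<and> (a + i \<in> LR \<or> i < h + 1 \<and> a + i \<in> upper_rows)"
      "\<And>i. i \<in> set A' \<longleftrightarrow> 0 \<le> i \<and> (int n + a + i \<in> LA
          \<or> (\<exists>k<Suc r. upper k \<and> int n + a + i = int k + int (queen k)))"
      "\<And>i. i \<in> set Y' \<longleftrightarrow> 0 \<le> i \<and> (\<exists>k<Suc r. upper k \<and> int n + i = int (queen k))"
    for R' A' Y' e'
    by (rule view.intro, unfold state.sel)
      (rule that h1 view.a_pos[OF V] view.below_a[OF V] view.M_pos[OF V, unfolded state.sel]
        view.below_M[OF V, unfolded state.sel] view.diags[OF V, unfolded state.sel]
        view.distinct_diags[OF V, unfolded state.sel]; assumption)+
  show ?thesis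
  proof (cases "upper r"; cases "int r \<in> upper_rows")
    assume c: "upper r" "int r \<in> upper_rows"
    then have "letter r = UU" by (simp add: letter_def)
    then show ?thesis using goal[OF e2 R1 A1 Y1] c s by simp
  next
    assume c: "upper r" "int r \<notin> upper_rows"
    then have "letter r = UL" by (simp add: letter_def)
    then show ?thesis using goal[OF e2 R2 A1 Y1] c s by simp
  next
    assume c: "\<not> upper r" "int r \<in> upper_rows"
    then have "letter r = LU" by (simp add: letter_def)
    then show ?thesis using goal[OF e1 R1 A2 Y2] c s by simp
  next
    assume c: "\<not> upper r" "int r \<notin> upper_rows"
    then have "letter r = LL" by (simp add: letter_def)
    then show ?thesis using goal[OF e1 R2 A2 Y2] c s by simp
  qed
qed

section \<open>Filling a column\<close>

text \<open>Moving from column \<open>n\<close> to the next one, and on to the next rows and diagonals not known to be used.\<close>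
definition advance :: "int \<Rightarrow> int list \<Rightarrow> int list \<Rightarrow> int list \<Rightarrow> int list \<Rightarrow> int \<Rightarrow> int \<Rightarrow> state option" where
  "advance m D R A Y h e = (let t = gap 0 R; k = gap 0 D in
     if t < h then Some (State (m + k + t - 1) (shift k D) (shift t R) (shift (t + 1) A) (shift 1 Y) (h - t) (e - 1))
     else None)"

lemma advance_sound:
  assumes V: "view n LR LD LA a r (State m D R A Y h e)"
    and adv: "advance m D R A Y h e = Some s"
  shows "\<exists>a'. view (Suc n) LR LD LA a' r s"
proof -
  define t k where "t = gap 0 R" and "k = gap 0 D"
  have t: "0 \<le> t" "\<And>i. 0 \<le> i \<Longrightarrow> i < t \<Longrightarrow> i \<in> set R"
    and k: "0 \<le> k" "\<And>i. 0 \<le> i \<Longrightarrow> i < k \<Longrightarrow> i \<in> set D"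
    using gap_filled[of 0] gap_ge[of 0] by (auto simp: t_def k_def)
  have s: "s = State (m + k + t - 1) (shift k D) (shift t R) (shift (t + 1) A) (shift 1 Y) (h - t) (e - 1)"
    using adv by (auto simp: advance_def t_def k_def Let_def split: if_splits)
  note h = view.horizon[OF V, unfolded state.sel] and e = view.excess[OF V, unfolded state.sel]
    and R = view.rows[OF V, unfolded state.sel] and A = view.antis[OF V, unfolded state.sel]
    and Y = view.uppers[OF V, unfolded state.sel] and D = view.diags[OF V, unfolded state.sel]
    and M = view.M_pos[OF V, unfolded state.sel] view.below_M[OF V, unfolded state.sel]
    and a = view.a_pos[OF V] view.below_a[OF V]
  have M': "int (Suc n) - (a + t) + (m + k + t - 1) = int n - a + m + k" by simp
  have "view (Suc n) LR LD LA (a + t) r s"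
    unfolding s
  proof (rule view.intro, unfold state.sel M')
    fix y assume y: "0 < y" "y < a + t"
    show "y \<in> upper_rows \<union> LR"
    proof (cases "y < a")
      case False
      then have "y - a \<in> set R" using y t(2)[of "y - a"] by simp
      then show ?thesis using R[of "y - a"] by auto
    qed (use y a in auto)
  next
    fix d assume d: "0 < d" "d < int n - a + m + k"
    show "d \<in> LD"
    proof (cases "d < int n - a + m")
      case False
      then have "d - (int n - a + m) \<in> set D" using d k(2)[of "d - (int n - a + m)"] by simp
      then show ?thesis using D[of "d - (int n - a + m)"] by simp
    qed (use d M in auto)
  next
    show "0 < a + t" using a(1) t(1) by simp
    show "h - t = int r - (a + t)" using h by simp
    show "e - 1 = int r + int (uppers_below r) - int (Suc n)" using e by simp
    show "0 < int n - a + m + k" using M(1) k(1) by simp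
    show "distinct (shift k D)" using view.distinct_diags[OF V] by (simp add: distinct_shift)
    fix i
    show "i \<in> set (shift t R) \<longleftrightarrow> 0 \<le> i \<and> (a + t + i \<in> LR \<or> i < h - t \<and> a + t + i \<in> upper_rows)"
      unfolding set_shift R using t(1) by (auto simp: algebra_simps)
    show "i \<in> set (shift (t + 1) A) \<longleftrightarrow> 0 \<le> i \<and> (int (Suc n) + (a + t) + i \<in> LA
          \<or> (\<exists>k<r. upper k \<and> int (Suc n) + (a + t) + i = int k + int (queen k)))"
    proof -
      have "int n + a + (i + (t + 1)) = int (Suc n) + (a + t) + i" by simp
      then show ?thesis unfolding set_shift A by (simp only:) (use t(1) in auto)
    qed
    show "i \<in> set (shift 1 Y) \<longleftrightarrow> 0 \<le> i \<and> (\<exists>k<r. upper k \<and> int (Suc n) + i = int (queen k))"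
    proof -
      have "int n + (i + 1) = int (Suc n) + i" by simp
      then show ?thesis unfolding set_shift Y by (simp only:) auto
    qed
    show "i \<in> set (shift k D) \<longleftrightarrow> 0 \<le> i \<and> int n - a + m + k + i \<in> LD"
    proof -
      have "int n - a + m + (i + k) = int n - a + m + k + i" by simp
      then show ?thesis unfolding set_shift D by (simp only:) (use k(1) in auto)
    qed
  qed
  then show ?thesis by blast
qed

text \<open>The lowest free square of the column, as an offset from \<open>a\<close>.\<close>
definition candidate :: "int \<Rightarrow> int list \<Rightarrow> int list \<Rightarrow> int list \<Rightarrow> int option" where
  "candidate m D R A = find (\<lambda>i. i \<notin> set R \<and> i \<notin> set A \<and> - m - i \<notin> set D) [0..- m]"

text \<open>
  The result is undefined unless enough letters have been read to decide what happens in the column,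
  and also if a lower queen would violate the bound of the theorem. Before that queen is placed, the number of
  lower queens is \<open>M - 1\<close> plus the length of \<open>D\<close>, and its diagonal is \<open>M - m - i\<close>; this explains the
  expression for the deviation.
\<close>
fun step :: "state \<Rightarrow> (letter \<times> state) option" where
  "step (State m D R A Y h e) =
    (if 0 < h \<and> - m < h \<and> 0 \<le> e \<and> - m \<le> h + e then
       (case candidate m D R A of
          None \<Rightarrow> map_option (Pair (mk_letter True (0 \<in> set Y))) (advance m D R A Y h e)
        | Some i \<Rightarrow>
           if \<bar>- m - i - int (length D)\<bar> \<le> 4
           then map_option (Pair (mk_letter False (0 \<in> set Y)))
                  (advance m (ins (- m - i) D) (ins i R) (ins i A) Y h e)
           else None)
     else None)"

text \<open>Different lower queens have different diagonals, so the diagonals count the lower columns.\<close>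
lemma lowers_below_view:
  assumes "view n LR (lower_diags n) LA a r (State m D R A Y h e)"
  shows "int (lowers_below n) = int n - a + m - 1 + int (length D)"
proof -
  define M where "M = int n - a + m"
  note V = view.M_pos[OF assms, unfolded state.sel, folded M_def]
    view.below_M[OF assms, unfolded state.sel, folded M_def]
    view.diags[OF assms, unfolded state.sel, folded M_def]
    view.distinct_diags[OF assms, unfolded state.sel]
  have "lower_diags n = {1..<M} \<union> (\<lambda>i. M + i) ` set D"
  proof (intro set_eqI iffI)
    fix d assume d: "d \<in> lower_diags n"
    then have "0 < d" by (auto simp: lower_diags_def lower_def)
    show "d \<in> {1..<M} \<union> (\<lambda>i. M + i) ` set D"
    proof (cases "d < M")
      case False
      then have "d - M \<in> set D" using V(3)[of "d - M"] d by simp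
      then have "d \<in> (\<lambda>i. M + i) ` set D" by (intro image_eqI[of _ _ "d - M"]) auto
      then show ?thesis by blast
    qed (use \<open>0 < d\<close> in auto)
  qed (use V in auto)
  moreover have "{1..<M} \<inter> (\<lambda>i. M + i) ` set D = {}" using V(3) by fastforce
  moreover have "card ((\<lambda>i. M + i) ` set D) = length D"
    using V(4) by (simp add: card_image distinct_card)
  ultimately have "card (lower_diags n) = nat (M - 1) + length D"
    by (simp add: card_Un_disjoint)
  then show ?thesis using V(1) by (simp add: card_lower_diags M_def)
qed

text \<open>
  The squares \<open>(n, a + i)\<close> with \<open>i > - m\<close> are on used diagonals. For the others the state knows all that
  matters: upper queens from column \<open>r\<close> on are at least \<open>h + e + 1\<close> antidiagonals above \<open>(n, a)\<close>.
\<close>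
lemma free_square_view:
  assumes V: "view_at n a r (State m D R A Y h e)"
    and c: "0 < h" "- m < h" "- m \<le> h + e"
  shows "y < n \<and> free_square n y \<longleftrightarrow>
     (\<exists>i. int y = a + i \<and> 0 \<le> i \<and> i \<le> - m \<and> i \<notin> set R \<and> i \<notin> set A \<and> - m - i \<notin> set D)"
    (is "?L \<longleftrightarrow> ?R")
proof -
  note h = view.horizon[OF V, unfolded state.sel] and e = view.excess[OF V, unfolded state.sel]
    and R = view.rows[OF V, unfolded state.sel] and A = view.antis[OF V, unfolded state.sel]
    and D = view.diags[OF V, unfolded state.sel]
    and M = view.M_pos[OF V, unfolded state.sel] view.below_M[OF V, unfolded state.sel]
    and a = view.a_pos[OF V] view.below_a[OF V]
  have anti: "int n + a + i \<in> upper_antis \<longleftrightarrow> (\<exists>k<r. upper k \<and> int n + a + i = int k + int (queen k))"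
    if "i \<le> - m" for i
  proof
    assume "int n + a + i \<in> upper_antis"
    then obtain k where k: "upper k" "int n + a + i = int k + int (queen k)"
      by (auto simp: upper_antis_def)
    have "k < r"
    proof (rule ccontr)
      assume "\<not> k < r"
      then have "r \<le> k" by simp
      then have "int r \<le> int k" "int (uppers_below r) \<le> int (uppers_below k)"
        using uppers_below_mono by auto
      then show False using k(2) queen_upper[OF k(1)] e h that c(3) by simp
    qed
    with k show "\<exists>k<r. upper k \<and> int n + a + i = int k + int (queen k)" by blast
  qed (auto simp: upper_antis_def)
  show ?thesis
  proof
    assume ?L
    then have y: "y < n" and F: "0 < y" "int y \<notin> upper_rows" "int y \<notin> lower_rows n"
      "int n - int y \<notin> lower_diags n" "int n + int y \<notin> upper_antis" "int n + int y \<notin> lower_antis n"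
      using free_square_iff[of y n] by auto
    have "a \<le> int y" using a(2)[of "int y"] F(1-3) by force
    moreover have "int y - a \<le> - m"
      using M(2)[of "int n - int y"] F(4) y by force
    moreover have "int y - a \<notin> set R" using R[of "int y - a"] F(2,3) by auto
    moreover have "int y - a \<notin> set A"
      using A[of "int y - a"] anti[of "int y - a"] F(5,6) \<open>int y - a \<le> - m\<close> by (simp add: algebra_simps)
    moreover have "- m - (int y - a) \<notin> set D"
      using D[of "- m - (int y - a)"] F(4) by (auto simp: algebra_simps)
    ultimately show ?R by (intro exI[of _ "int y - a"]) simp
  next
    assume ?R
    then obtain i where i: "int y = a + i" "0 \<le> i" "i \<le> - m" "i \<notin> set R" "i \<notin> set A" "- m - i \<notin> set D" by blast
    have "y < n" using M(1) i(1,3) by linarith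
    moreover have "0 < y" using a(1) i(1,2) by linarith
    moreover have "int y \<notin> upper_rows" "int y \<notin> lower_rows n"
      using R[of i] i c(2) by auto
    moreover have "int n - int y \<notin> lower_diags n"
      using D[of "- m - i"] i by (simp add: algebra_simps)
    moreover have "int n + int y \<notin> upper_antis" "int n + int y \<notin> lower_antis n"
      using A[of i] anti[of i] i by (simp_all add: algebra_simps)
    ultimately show ?L using free_square_iff[of y n] by simp
  qed
qed

text \<open>An upper queen in row \<open>n\<close> stands before column \<open>r\<close>, as later ones have row at least \<open>n + e + 1\<close>.\<close>
lemma row_letter_view:
  assumes V: "view_at n a r (State m D R A Y h e)" and "0 \<le> e"
  shows "int n \<in> upper_rows \<longleftrightarrow> 0 \<in> set Y"
proof -
  note e = view.excess[OF V, unfolded state.sel] and Y = view.uppers[OF V, unfolded state.sel, of 0]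
  show ?thesis
  proof
    assume "int n \<in> upper_rows"
    then obtain k where k: "upper k" "n = queen k" by (auto simp: upper_rows_def)
    have "k < r"
    proof (rule ccontr)
      assume "\<not> k < r"
      then have "r \<le> k" by simp
      then have "int r \<le> int k" "int (uppers_below r) \<le> int (uppers_below k)"
        using uppers_below_mono by auto
      then show False using k(2) queen_upper[OF k(1)] e \<open>0 \<le> e\<close> by simp
    qed
    then show "0 \<in> set Y" using k Y by auto
  qed (use Y in \<open>auto simp: upper_rows_def\<close>)
qed

lemma view_insert:
  assumes V: "view n LR LD LA a r (State m D R A Y h e)" and i: "0 \<le> i" "i \<le> - m" "- m - i \<notin> set D"
  shows "view n (insert (a + i) LR) (insert (int n - (a + i)) LD) (insert (int n + (a + i)) LA) a r
     (State m (ins (- m - i) D) (ins i R) (ins i A) Y h e)"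
proof -
  note h = view.horizon[OF V, unfolded state.sel] and e = view.excess[OF V, unfolded state.sel]
    and R = view.rows[OF V, unfolded state.sel] and A = view.antis[OF V, unfolded state.sel]
    and Y = view.uppers[OF V, unfolded state.sel] and D = view.diags[OF V, unfolded state.sel]
    and M = view.M_pos[OF V, unfolded state.sel] view.below_M[OF V, unfolded state.sel]
    and a = view.a_pos[OF V] view.below_a[OF V]
  show ?thesis
  proof (rule view.intro, unfold state.sel set_ins)
    fix j
    show "j \<in> insert i (set R) \<longleftrightarrow> 0 \<le> j \<and> (a + j \<in> insert (a + i) LR \<or> j < h \<and> a + j \<in> upper_rows)"
      using i(1) R[of j] by auto
    show "j \<in> insert i (set A) \<longleftrightarrow> 0 \<le> j \<and> (int n + a + j \<in> insert (int n + (a + i)) LA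
          \<or> (\<exists>k<r. upper k \<and> int n + a + j = int k + int (queen k)))"
      using i(1) A[of j] by auto
    show "j \<in> set Y \<longleftrightarrow> 0 \<le> j \<and> (\<exists>k<r. upper k \<and> int n + j = int (queen k))" by (rule Y)
    show "j \<in> insert (- m - i) (set D) \<longleftrightarrow> 0 \<le> j \<and> int n - a + m + j \<in> insert (int n - (a + i)) LD"
      using i(2) D[of j] by auto
  next
    fix y assume "0 < y" "y < a"
    then show "y \<in> upper_rows \<union> insert (a + i) LR" using a(2) by blast
  next
    fix d assume "0 < d" "d < int n - a + m"
    then show "d \<in> insert (int n - (a + i)) LD" using M(2) by blast
  next
    show "distinct (ins (- m - i) D)"
      using view.distinct_diags[OF V] i(3) by (simp add: distinct_ins)
  qed (rule a h e M)+
qed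

text \<open>The transducer writes the right letter, and its new state describes the next column.\<close>
lemma step_sound:
  assumes n: "0 < n" and V: "view_at n a r s" and st: "step s = Some (c, s')"
  shows "letter n = c" (is ?letter)
    and "\<exists>a'. view_at (Suc n) a' r s'" (is ?view)
    and "lower n \<Longrightarrow> \<bar>int n - int (queen n) - (int (lowers_below n) + 1)\<bar> \<le> 4" (is "_ \<Longrightarrow> ?bound")
proof -
  obtain m D R A Y h e where s: "s = State m D R A Y h e" by (cases s)
  have c: "0 < h" "- m < h" "0 \<le> e" "- m \<le> h + e"
    using st unfolding s by (auto split: if_splits)
  note V = V[unfolded s]
  note free = free_square_view[OF V c(1,2,4)]
  note row = row_letter_view[OF V c(3)]
  have "?letter \<and> ?view \<and> (lower n \<longrightarrow> ?bound)"
  proof (cases "candidate m D R A")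
    case None
    have "\<not> (y < n \<and> free_square n y)" for y
      using None unfolding free candidate_def by (auto simp: find_None_iff)
    then have "\<not> lower n" using lower_iff_free[OF n] by blast
    moreover obtain "advance m D R A Y h e = Some s'" "c = mk_letter True (0 \<in> set Y)"
      using st None c unfolding s by auto
    moreover have "\<exists>a'. view (Suc n) (lower_rows n) (lower_diags n) (lower_antis n) a' r s'"
      using advance_sound[OF V] calculation by blast
    ultimately show ?thesis
      using row upper_iff_not_lower[OF n] by (auto simp: letter_def lower_sets_Suc)
  next
    case (Some i)
    from Some have i: "0 \<le> i" "i \<le> - m" "i \<notin> set R" "i \<notin> set A" "- m - i \<notin> set D"
      unfolding candidate_def by (auto simp: find_Some_iff)
    have least: "i \<le> j" if "0 \<le> j" "j \<le> - m" "j \<notin> set R" "j \<notin> set A" "- m - j \<notin> set D" for j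
    proof (rule ccontr)
      assume "\<not> i \<le> j"
      from Some obtain k where k: "k < length [0..- m]" "i = [0..- m] ! k"
        "\<forall>l<k. \<not> ([0..- m] ! l \<notin> set R \<and> [0..- m] ! l \<notin> set A \<and> - m - [0..- m] ! l \<notin> set D)"
        unfolding candidate_def by (auto simp: find_Some_iff)
      have "nat j < k" "[0..- m] ! nat j = j"
        using \<open>\<not> i \<le> j\<close> k(1,2) that(1,2) by auto
      with k(3) that(3-5) show False by fastforce
    qed
    have "0 \<le> a" using view.a_pos[OF V] by simp
    define y where "y = nat (a + i)"
    have y: "int y = a + i" using \<open>0 \<le> a\<close> i by (simp add: y_def)
    have fr: "y < n" "free_square n y" using free[of y] y i by auto
    then have low: "lower n" using lower_iff_free[OF n] by blast
    have "queen n \<le> y" using queen_le_free[OF n fr(2)] .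
    moreover have "y \<le> queen n"
    proof -
      have "queen n < n" "free_square n (queen n)" using low queen_free[OF n] by (auto simp: lower_def)
      then obtain j where "int (queen n) = a + j" "0 \<le> j" "j \<le> - m" "j \<notin> set R" "j \<notin> set A" "- m - j \<notin> set D"
        using free[of "queen n"] by blast
      with least[of j] y show ?thesis by simp
    qed
    ultimately have q: "int (queen n) = a + i" using y by simp
    obtain adv: "advance m (ins (- m - i) D) (ins i R) (ins i A) Y h e = Some s'"
      and cc: "c = mk_letter False (0 \<in> set Y)" and b: "\<bar>- m - i - int (length D)\<bar> \<le> 4"
      using st Some c unfolding s by (auto split: if_splits)
    have "\<exists>a'. view (Suc n) (lower_rows (Suc n)) (lower_diags (Suc n)) (lower_antis (Suc n)) a' r s'"
      using advance_sound[OF view_insert[OF V i(1,2,5)] adv] low q by (simp add: lower_sets_Suc)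
    moreover have ?bound using b lowers_below_view[OF V] q by (simp add: algebra_simps)
    ultimately show ?thesis
      using row upper_iff_not_lower[OF n] low cc by (auto simp: letter_def)
  qed
  then show ?letter ?view "lower n \<Longrightarrow> ?bound" by blast+
qed

section \<open>The certificate\<close>

text \<open>
  A finite map from positive numbers, addressed by their binary digits starting with the lowest.
  \<open>Delay\<close> keeps a block of the map folded behind a function: the simplifier, which normalises the arguments
  of \<open>look\<close> before it descends, unfolds only the block that a key leads to.
\<close>
datatype 'a trie = Tip | Node "'a trie" 'a "'a trie" | Delay "unit \<Rightarrow> 'a trie"

primrec look :: "'a trie \<Rightarrow> num \<Rightarrow> 'a option" where
  "look Tip k = None"
| "look (Node l x r) k = (case k of num.One \<Rightarrow> Some x | num.Bit0 j \<Rightarrow> look l j | num.Bit1 j \<Rightarrow> look r j)"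
| "look (Delay f) k = look (f ()) k"

text \<open>Equations by pattern matching are evaluated much faster than case expressions.\<close>
lemma look_code [code]:
  "look Tip k = None"
  "look (Node l x r) num.One = Some x"
  "look (Node l x r) (num.Bit0 j) = look l j"
  "look (Node l x r) (num.Bit1 j) = look r j"
  "look (Delay f) k = look (f ()) k"
  by simp_all

text \<open>Keys are integers because there are no numerals of type \<open>num\<close>.\<close>
definition entry :: "'a trie \<Rightarrow> int \<Rightarrow> 'a option" where
  "entry t k = (if 0 < k then look t (num_of_nat (nat k)) else None)"

lemma entry_code [code]:
  "entry t 0 = None" "entry t (Int.Pos k) = look t k" "entry t (Int.Neg k) = None"
  by (simp_all add: entry_def Int.Pos_def Int.Neg_def num_of_nat_numeral_eq)

text \<open>
  What the transducer does from a given state until column \<open>n\<close> is filled. \<open>Move c j\<close> writes \<open>c\<close> and goes to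
  the state with number \<open>j\<close>; \<open>Read\<close> branches on the next letter of the tape, in the order UU, UL, LU, LL;
  \<open>Stop\<close> marks a letter that the automaton excludes.
\<close>
datatype tree = Stop | Move letter int | Read tree tree tree tree

text \<open>
  The automaton that accepts the tape from position 20 on: for each of its states the successors under
  UU, UL, LU and LL, where 0 means that the letter is impossible. It comes from the subwords of length 13
  in a long initial segment of the tape, enlarged until the closure checked below held, with
  states merged as long as it survived. Its correctness rests on that check alone.
\<close>
definition tape_automaton_0 :: "unit \<Rightarrow> (int \<times> int \<times> int \<times> int) trie" where
  "tape_automaton_0 _ =
     Node (Node (Node (Node (Node Tip (0, 88, 0, 0) Tip) (0, 165, 0, 0) (Node Tip (129, 0, 0, 105) Tip)) (2, 88,
     89, 90) (Node (Node Tip (0, 0, 345, 0) Tip) (0, 239, 0, 0) Tip)) (0, 49, 0, 50) (Node (Node (Node Tip (319,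
     320, 21, 0) Tip) (2, 202, 11, 0) Tip) (134, 0, 0, 0) (Node (Node Tip (19, 320, 21, 0) Tip) (0, 0, 265, 105)
     Tip))) (0, 25, 26, 27) (Node (Node (Node (Node Tip (0, 310, 0, 142) Tip) (183, 0, 0, 0) Tip) (0, 0, 0, 112)
     (Node (Node Tip (0, 0, 358, 0) Tip) (0, 0, 0, 120) Tip)) (0, 0, 70, 0) (Node (Node (Node Tip (0, 242, 0, 84)
     Tip) (0, 57, 0, 0) Tip) (151, 0, 0, 0) (Node (Node Tip (0, 0, 0, 378) Tip) (0, 278, 279, 280) Tip)))"

definition tape_automaton_1 :: "unit \<Rightarrow> (int \<times> int \<times> int \<times> int) trie" where
  "tape_automaton_1 _ =
     Node (Node (Node (Node (Node Tip (305, 0, 0, 0) Tip) (0, 0, 0, 174) Tip) (0, 102, 0, 0) (Node (Node Tip (0,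
     352, 0, 0) Tip) (128, 246, 0, 0) Tip)) (60, 0, 61, 0) (Node (Node (Node Tip (0, 324, 0, 0) Tip) (213, 0, 214,
     0) Tip) (143, 144, 0, 0) (Node (Node Tip (2, 0, 4, 0) Tip) (0, 0, 0, 271) Tip))) (0, 0, 0, 36) (Node (Node
     (Node (Node Tip (245, 253, 0, 0) Tip) (189, 0, 190, 191) Tip) (124, 25, 125, 126) (Node (Node Tip (0, 48, 0,
     0) Tip) (0, 0, 0, 246) Tip)) (0, 78, 0, 79) (Node (Node (Node Tip (0, 0, 0, 339) Tip) (230, 25, 0, 231) Tip)
     (159, 0, 0, 0) (Node (Node Tip (382, 0, 0, 0) Tip) (0, 288, 0, 0) Tip)))"

definition tape_automaton_2 :: "unit \<Rightarrow> (int \<times> int \<times> int \<times> int) trie" where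
  "tape_automaton_2 _ =
     Node (Node (Node (Node (Node Tip (0, 300, 169, 0) Tip) (0, 170, 0, 0) Tip) (0, 96, 0, 97) (Node (Node Tip
     (348, 0, 0, 0) Tip) (0, 0, 0, 243) Tip)) (54, 55, 0, 0) (Node (Node (Node Tip (221, 253, 0, 0) Tip) (0, 96, 0,
     92) Tip) (137, 0, 0, 0) (Node (Node Tip (0, 371, 0, 0) Tip) (193, 0, 0, 0) Tip))) (0, 0, 32, 0) (Node (Node
     (Node (Node Tip (312, 0, 0, 0) Tip) (0, 186, 0, 0) Tip) (117, 0, 0, 0) (Node (Node Tip (0, 0, 0, 360) Tip)
     (255, 0, 0, 0) Tip)) (74, 0, 0, 0) (Node (Node (Node Tip (335, 25, 0, 297) Tip) (0, 226, 227, 0) Tip) (111,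
     155, 0, 0) (Node (Node Tip (0, 0, 227, 0) Tip) (0, 284, 0, 285) Tip)))"

definition tape_automaton_3 :: "unit \<Rightarrow> (int \<times> int \<times> int \<times> int) trie" where
  "tape_automaton_3 _ =
     Node (Node (Node (Node (Node Tip (0, 0, 0, 309) Tip) (0, 179, 0, 0) Tip) (106, 0, 0, 107) (Node (Node Tip
     (268, 0, 0, 0) Tip) (0, 0, 0, 249) Tip)) (65, 0, 0, 0) (Node (Node (Node Tip (129, 0, 328, 231) Tip) (2, 209,
     11, 218) Tip) (121, 0, 0, 0) (Node (Node Tip (361, 0, 0, 0) Tip) (0, 275, 0, 0) Tip))) (41, 42, 0, 0) (Node
     (Node (Node (Node Tip (318, 0, 0, 142) Tip) (196, 0, 0, 197) Tip) (130, 0, 0, 0) (Node (Node Tip (0, 0, 0,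
     366) Tip) (261, 0, 0, 0) Tip)) (0, 0, 0, 84) (Node (Node (Node Tip (2, 283, 11, 0) Tip) (198, 234, 0, 197)
     Tip) (0, 0, 0, 163) (Node (Node Tip (0, 0, 137, 0) Tip) (0, 293, 0, 0) Tip)))"

definition tape_automaton_4 :: "unit \<Rightarrow> (int \<times> int \<times> int \<times> int) trie" where
  "tape_automaton_4 _ =
     Node (Node (Node (Node (Node Tip (43, 25, 0, 297) Tip) (0, 167, 0, 0) (Node Tip (0, 156, 0, 321) Tip)) (93,
     81, 0, 94) (Node (Node Tip (347, 0, 0, 297) Tip) (241, 0, 0, 0) Tip)) (0, 52, 0, 0) (Node (Node (Node Tip (0,
     0, 0, 142) Tip) (0, 204, 0, 205) Tip) (0, 0, 0, 136) (Node (Node Tip (368, 0, 369, 191) Tip) (129, 25, 0, 231)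
     Tip))) (0, 29, 14, 30) (Node (Node (Node (Node Tip (0, 259, 214, 0) Tip) (0, 184, 0, 0) Tip) (115, 0, 0, 0)
     (Node (Node Tip (295, 0, 11, 0) Tip) (128, 253, 0, 0) Tip)) (72, 0, 0, 0) (Node (Node (Node Tip (0, 333, 0, 0)
     Tip) (0, 223, 0, 0) Tip) (153, 0, 0, 0) (Node (Node Tip (121, 122, 0, 0) Tip) (282, 0, 0, 0) Tip)))"

definition tape_automaton_5 :: "unit \<Rightarrow> (int \<times> int \<times> int \<times> int) trie" where
  "tape_automaton_5 _ =
     Node (Node (Node (Node (Node Tip (0, 307, 0, 0) Tip) (0, 0, 176, 177) Tip) (0, 103, 0, 104) (Node (Node Tip
     (0, 0, 0, 354) Tip) (0, 0, 248, 0) Tip)) (63, 0, 0, 0) (Node (Node (Node Tip (0, 325, 0, 326) Tip) (193, 216,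
     0, 142) Tip) (0, 0, 0, 146) (Node (Node Tip (0, 0, 373, 0) Tip) (0, 273, 0, 0) Tip))) (0, 0, 0, 38) (Node
     (Node (Node (Node Tip (0, 0, 0, 316) Tip) (193, 0, 0, 194) Tip) (128, 114, 0, 0) (Node (Node Tip (0, 364, 0,
     0) Tip) (9, 253, 0, 0) Tip)) (0, 81, 0, 82) (Node (Node (Node Tip (0, 29, 14, 0) Tip) (232, 25, 0, 126) Tip)
     (161, 0, 0, 0) (Node (Node Tip (0, 168, 0, 0) Tip) (0, 290, 0, 0) Tip)))"

definition tape_automaton_6 :: "unit \<Rightarrow> (int \<times> int \<times> int \<times> int) trie" where
  "tape_automaton_6 _ =
     Node (Node (Node (Node (Node Tip (207, 302, 0, 303) Tip) (0, 0, 0, 172) Tip) (0, 99, 0, 100) (Node (Node Tip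
     (350, 0, 0, 0) Tip) (0, 0, 0, 148) Tip)) (56, 57, 0, 0) (Node (Node (Node Tip (0, 322, 0, 84) Tip) (2, 209,
     11, 210) Tip) (0, 0, 140, 0) (Node (Node Tip (0, 352, 0, 13) Tip) (0, 0, 0, 269) Tip))) (0, 0, 34, 0) (Node
     (Node (Node (Node Tip (0, 0, 125, 0) Tip) (141, 0, 0, 0) Tip) (119, 25, 0, 120) (Node (Node Tip (319, 362, 21,
     0) Tip) (0, 0, 0, 257) Tip)) (0, 76, 0, 0) (Node (Node (Node Tip (337, 0, 0, 0) Tip) (211, 0, 0, 107) Tip) (0,
     157, 0, 144) (Node (Node Tip (0, 0, 0, 380) Tip) (286, 0, 0, 0) Tip)))"

definition tape_automaton_7 :: "unit \<Rightarrow> (int \<times> int \<times> int \<times> int) trie" where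
  "tape_automaton_7 _ =
     Node (Node (Node (Node (Node Tip (0, 96, 0, 285) Tip) (181, 0, 0, 0) Tip) (0, 0, 109, 110) (Node (Node Tip
     (356, 0, 0, 0) Tip) (0, 0, 0, 231) Tip)) (68, 0, 61, 0) (Node (Node (Node Tip (330, 0, 0, 324) Tip) (0, 220,
     0, 0) Tip) (149, 0, 0, 0) (Node (Node Tip (0, 376, 0, 0) Tip) (277, 0, 0, 0) Tip))) (45, 46, 0, 0) (Node (Node
     (Node (Node Tip (0, 0, 0, 239) Tip) (0, 88, 199, 200) Tip) (132, 0, 0, 0) (Node (Node Tip (0, 78, 0, 0) Tip)
     (0, 263, 0, 0) Tip)) (0, 86, 0, 0) (Node (Node (Node Tip (0, 0, 0, 343) Tip) (0, 236, 0, 0) Tip) (164, 0, 0,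
     0) (Node (Node Tip (0, 0, 0, 385) Tip) (295, 283, 227, 0) Tip)))"

definition tape_automaton_8 :: "unit \<Rightarrow> (int \<times> int \<times> int \<times> int) trie" where
  "tape_automaton_8 _ =
     Node (Node (Node (Node (Node Tip (0, 296, 0, 0) Tip) (0, 0, 0, 166) (Node Tip (386, 0, 0, 0) Tip)) (0, 91, 0,
     92) (Node (Node Tip (346, 0, 0, 0) Tip) (0, 0, 0, 240) Tip)) (51, 0, 0, 0) (Node (Node (Node Tip (0, 228, 0,
     321) Tip) (0, 0, 0, 203) Tip) (135, 0, 0, 0) (Node (Node Tip (367, 0, 0, 0) Tip) (266, 0, 0, 0) Tip))) (0, 0,
     0, 28) (Node (Node (Node (Node Tip (311, 0, 0, 0) Tip) (0, 96, 0, 0) Tip) (113, 0, 0, 114) (Node (Node Tip (0,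
     0, 0, 359) Tip) (0, 0, 252, 0) Tip)) (0, 0, 71, 0) (Node (Node (Node Tip (0, 332, 0, 0) Tip) (222, 0, 0, 0)
     Tip) (0, 0, 0, 152) (Node (Node Tip (0, 379, 0, 0) Tip) (0, 228, 0, 281) Tip)))"

definition tape_automaton_9 :: "unit \<Rightarrow> (int \<times> int \<times> int \<times> int) trie" where
  "tape_automaton_9 _ =
     Node (Node (Node (Node (Node Tip (0, 306, 0, 0) Tip) (0, 0, 0, 175) Tip) (0, 42, 0, 0) (Node (Node Tip (0, 0,
     0, 353) Tip) (129, 0, 0, 247) Tip)) (0, 62, 0, 0) (Node (Node (Node Tip (245, 0, 0, 0) Tip) (0, 215, 0, 0)
     Tip) (145, 0, 0, 0) (Node (Node Tip (0, 0, 0, 372) Tip) (0, 272, 0, 0) Tip))) (37, 0, 0, 0) (Node (Node (Node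
     (Node Tip (315, 0, 0, 0) Tip) (0, 0, 0, 192) Tip) (0, 127, 0, 0) (Node (Node Tip (0, 363, 0, 50) Tip) (0, 259,
     0, 0) Tip)) (80, 0, 0, 0) (Node (Node (Node Tip (340, 0, 0, 247) Tip) (193, 0, 0, 82) Tip) (0, 0, 0, 160)
     (Node (Node Tip (0, 15, 0, 0) Tip) (289, 0, 0, 0) Tip)))"

definition tape_automaton_10 :: "unit \<Rightarrow> (int \<times> int \<times> int \<times> int) trie" where
  "tape_automaton_10 _ =
     Node (Node (Node (Node (Node Tip (0, 0, 0, 301) Tip) (0, 108, 0, 171) Tip) (98, 0, 11, 0) (Node (Node Tip (0,
     349, 0, 0) Tip) (244, 0, 0, 0) Tip)) (0, 0, 0, 1) (Node (Node (Node Tip (19, 20, 21, 138) Tip) (207, 208, 26,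
     27) Tip) (0, 139, 0, 0) (Node (Node Tip (0, 88, 0, 90) Tip) (268, 0, 0, 105) Tip))) (0, 0, 0, 33) (Node (Node
     (Node (Node Tip (0, 313, 0, 0) Tip) (0, 0, 0, 187) Tip) (118, 0, 0, 0) (Node (Node Tip (361, 0, 0, 249) Tip)
     (0, 0, 0, 256) Tip)) (0, 75, 0, 0) (Node (Node (Node Tip (0, 336, 11, 0) Tip) (0, 228, 0, 0) Tip) (0, 156, 0,
     0) (Node (Node Tip (0, 49, 0, 0) Tip) (0, 91, 0, 0) Tip)))"

definition tape_automaton_11 :: "unit \<Rightarrow> (int \<times> int \<times> int \<times> int) trie" where
  "tape_automaton_11 _ =
     Node (Node (Node (Node (Node Tip (0, 88, 0, 210) Tip) (0, 0, 0, 180) Tip) (0, 108, 0, 0) (Node (Node Tip (0,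
     25, 0, 0) Tip) (250, 0, 0, 0) Tip)) (0, 66, 0, 67) (Node (Node (Node Tip (329, 0, 0, 0) Tip) (219, 0, 0, 197)
     Tip) (0, 148, 0, 0) (Node (Node Tip (0, 336, 0, 375) Tip) (0, 276, 0, 0) Tip))) (43, 25, 0, 44) (Node (Node
     (Node (Node Tip (143, 0, 0, 0) Tip) (198, 0, 0, 0) Tip) (0, 0, 0, 131) (Node (Node Tip (0, 0, 227, 27) Tip)
     (0, 262, 0, 0) Tip)) (0, 85, 0, 0) (Node (Node (Node Tip (0, 342, 0, 0) Tip) (0, 0, 0, 235) Tip) (0, 12, 0, 0)
     (Node (Node Tip (0, 384, 0, 0) Tip) (294, 0, 0, 0) Tip)))"

definition tape_automaton_12 :: "unit \<Rightarrow> (int \<times> int \<times> int \<times> int) trie" where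
  "tape_automaton_12 _ =
     Node (Node (Node (Node (Node Tip (0, 0, 298, 299) Tip) (0, 168, 169, 0) Tip) (54, 95, 0, 0) (Node (Node Tip
     (0, 0, 11, 0) Tip) (0, 242, 0, 0) Tip)) (0, 53, 0, 0) (Node (Node (Node Tip (230, 208, 317, 192) Tip) (0, 206,
     0, 0) Tip) (0, 0, 137, 138) (Node (Node Tip (0, 370, 0, 84) Tip) (0, 267, 0, 0) Tip))) (0, 0, 0, 31) (Node
     (Node (Node (Node Tip (230, 0, 0, 192) Tip) (0, 185, 0, 0) Tip) (0, 116, 0, 0) (Node (Node Tip (2, 291, 11, 0)
     Tip) (0, 0, 0, 254) Tip)) (0, 62, 0, 73) (Node (Node (Node Tip (219, 302, 0, 334) Tip) (0, 224, 0, 225) Tip)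
     (0, 154, 0, 0) (Node (Node Tip (193, 0, 0, 142) Tip) (0, 283, 169, 0) Tip)))"

definition tape_automaton_13 :: "unit \<Rightarrow> (int \<times> int \<times> int \<times> int) trie" where
  "tape_automaton_13 _ =
     Node (Node (Node (Node (Node Tip (0, 308, 0, 0) Tip) (0, 0, 178, 0) Tip) (43, 25, 0, 105) (Node (Node Tip
     (355, 0, 0, 0) Tip) (0, 0, 0, 155) Tip)) (0, 0, 0, 64) (Node (Node (Node Tip (327, 0, 0, 0) Tip) (217, 0, 0,
     0) Tip) (147, 0, 0, 0) (Node (Node Tip (374, 0, 71, 0) Tip) (0, 274, 0, 0) Tip))) (39, 40, 0, 0) (Node (Node
     (Node (Node Tip (0, 0, 317, 0) Tip) (195, 0, 0, 0) Tip) (129, 0, 0, 0) (Node (Node Tip (0, 0, 0, 365) Tip) (0,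
     0, 0, 260) Tip)) (0, 0, 83, 0) (Node (Node (Node Tip (0, 341, 0, 0) Tip) (233, 55, 0, 0) Tip) (162, 0, 0, 0)
     (Node (Node Tip (0, 383, 0, 0) Tip) (2, 291, 11, 292) Tip)))"

definition tape_automaton_14 :: "unit \<Rightarrow> (int \<times> int \<times> int \<times> int) trie" where
  "tape_automaton_14 _ =
     Node (Node (Node (Node (Node Tip (304, 0, 0, 0) Tip) (0, 173, 0, 0) Tip) (0, 0, 0, 101) (Node (Node Tip (0,
     351, 0, 0) Tip) (0, 245, 0, 0) Tip)) (0, 58, 0, 59) (Node (Node (Node Tip (0, 0, 0, 323) Tip) (211, 0, 0, 212)
     Tip) (141, 0, 0, 142) (Node (Node Tip (0, 0, 279, 0) Tip) (270, 0, 0, 0) Tip))) (0, 0, 35, 0) (Node (Node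
     (Node (Node Tip (0, 314, 0, 0) Tip) (0, 188, 0, 0) Tip) (121, 122, 0, 123) (Node (Node Tip (0, 278, 11, 0)
     Tip) (0, 258, 0, 0) Tip)) (77, 0, 0, 0) (Node (Node (Node Tip (0, 0, 0, 338) Tip) (0, 229, 0, 0) Tip) (0, 0,
     0, 158) (Node (Node Tip (381, 0, 0, 0) Tip) (287, 0, 0, 0) Tip)))"

definition tape_automaton_15 :: "unit \<Rightarrow> (int \<times> int \<times> int \<times> int) trie" where
  "tape_automaton_15 _ =
     Node (Node (Node (Node (Node Tip (0, 88, 11, 210) Tip) (0, 182, 0, 0) Tip) (111, 0, 0, 0) (Node (Node Tip (0,
     0, 0, 357) Tip) (0, 0, 0, 251) Tip)) (0, 0, 0, 69) (Node (Node (Node Tip (39, 331, 0, 0) Tip) (221, 0, 0, 0)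
     Tip) (0, 150, 0, 0) (Node (Node Tip (0, 259, 0, 377) Tip) (60, 0, 0, 0) Tip))) (47, 48, 0, 22) (Node (Node
     (Node (Node Tip (0, 0, 0, 92) Tip) (0, 201, 0, 92) Tip) (133, 0, 0, 0) (Node (Node Tip (134, 0, 0, 142) Tip)
     (74, 264, 0, 0) Tip)) (0, 87, 0, 0) (Node (Node (Node Tip (0, 0, 0, 344) Tip) (237, 238, 0, 0) Tip) (0, 29, 0,
     15) (Node (Node Tip (230, 0, 0, 0) Tip) (0, 228, 0, 285) Tip)))"

definition tape_automaton :: "(int \<times> int \<times> int \<times> int) trie" where
  "tape_automaton =
     Node (Node (Node (Node (Delay tape_automaton_0) (0, 0, 14, 15) (Delay tape_automaton_1)) (0, 8, 0, 0) (Node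
     (Delay tape_automaton_2) (19, 20, 21, 0) (Delay tape_automaton_3))) (0, 0, 0, 6) (Node (Node (Delay
     tape_automaton_4) (0, 0, 0, 17) (Delay tape_automaton_5)) (10, 0, 11, 0) (Node (Delay tape_automaton_6) (0,
     23, 0, 0) (Delay tape_automaton_7)))) (2, 3, 4, 5) (Node (Node (Node (Delay tape_automaton_8) (0, 16, 0, 0)
     (Delay tape_automaton_9)) (9, 0, 0, 0) (Node (Delay tape_automaton_10) (0, 22, 0, 0) (Delay
     tape_automaton_11))) (0, 0, 7, 0) (Node (Node (Delay tape_automaton_12) (0, 18, 0, 0) (Delay
     tape_automaton_13)) (0, 12, 0, 13) (Node (Delay tape_automaton_14) (24, 0, 0, 0) (Delay tape_automaton_15))))"

text \<open>The 160 memory states of the transducer, with their decision trees.\<close>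
definition view_table_0 :: "unit \<Rightarrow> (state \<times> tree) trie" where
  "view_table_0 _ =
     Node (Node (Node (Node Tip (State (- 2) [1] [1] [] [] 2 1, (Read Stop (Move LL 32) Stop (Move LL 25))) Tip)
     (State 1 [1] [] [2] [0, 2] 1 3, (Move UU 16)) Tip) (State (- 1) [1, 2] [] [1] [1] 1 2, (Read (Move UL 62)
     (Move UL 42) (Move UL 134) (Move UL 41))) (Node (Node Tip (State 0 [] [1, 2] [2] [1] 3 3, (Read Stop Stop
     (Read Stop (Move LL 76) Stop Stop) Stop)) Tip) (State (- 3) [1, 2, 3, 4] [1] [6] [0, 4] 3 5, (Read Stop (Move
     LU 108) Stop Stop)) Tip)) (State 0 [1] [] [1] [1] 1 2, (Read (Read Stop Stop Stop (Move LL 18)) (Move LL 12)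
     (Read Stop (Move LL 23) Stop (Move LL 19)) (Move LL 35))) (Node (Node (Node Tip (State (- 3) [1, 2, 3, 4] [1]
     [3, 6] [2, 4] 3 5, (Read (Move UL 147) Stop Stop Stop)) Tip) (State 0 [] [1, 2] [0, 2] [1] 3 3, (Move UL 90))
     Tip) (State (- 1) [] [1] [] [] 2 0, (Read (Read Stop (Move LL 64) Stop (Move LL 63)) Stop Stop Stop)) (Node
     Tip (State 0 [] [1, 3, 4] [2, 3, 9] [1, 5] 5 6, (Move LL 120)) Tip))"

definition view_table_1 :: "unit \<Rightarrow> (state \<times> tree) trie" where
  "view_table_1 _ =
     Node (Node (Node (Node Tip (State (- 3) [1, 2, 3] [1] [2] [1] 3 3, (Read (Move UL 139) Stop Stop Stop)) Tip)
     (State (- 3) [1, 2, 3] [1] [0, 3] [0, 2] 3 4, (Read (Move UU 84) Stop (Move UU 85) (Move UU 83))) Tip) (State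
     (- 2) [1, 2] [1] [] [] 2 1, (Read Stop (Move LL 52) Stop Stop)) (Node Tip (State (- 4) [1, 2, 3, 4] [1, 3] [0,
     3] [0, 2] 4 5, (Read Stop (Move LU 112) Stop Stop)) Tip)) (State (- 1) [1] [] [0] [0] 1 1, (Read (Move UU 27)
     (Move LU 37) (Move UU 128) (Move LU 36))) (Node (Node (Node Tip (State 2 [1] [] [1] [2] 1 4, (Move UL 65))
     Tip) (State 2 [1] [] [1] [0, 2] 1 4, (Move UU 65)) Tip) (State 0 [2] [] [] [] 1 1, (Read (Read Stop (Move LL
     73) Stop (Move LL 148)) Stop Stop Stop)) (Node Tip (State 2 [] [1, 2] [0, 6] [0, 4] 3 5, (Move UU 126)) Tip))"

definition view_table_2 :: "unit \<Rightarrow> (state \<times> tree) trie" where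
  "view_table_2 _ =
     Node (Node (Node (Node Tip (State (- 3) [1, 2, 3] [2] [0, 3, 6] [0, 2, 4] 3 5, (Read Stop Stop Stop (Move UU
     135))) Tip) (State 4 [] [] [1, 4] [0, 2, 4] 1 5, (Move UU 29)) Tip) (State 0 [] [1] [0] [] 2 1, (Move UL 48))
     (Node Tip (State 0 [] [1, 2] [1, 4] [0, 2] 3 3, (Read (Read Stop Stop Stop (Move LU 98)) Stop Stop (Move LU
     28))) Tip)) (State (- 1) [1] [] [] [] 1 0, (Read (Move UL 22) (Move LL 26) Stop Stop)) (Node (Node (Node Tip
     (State 2 [1] [] [0] [1] 1 3, (Move UL 63)) Tip) (State (- 4) [1, 2, 3] [1, 3] [2, 7] [1, 4] 4 5, (Read Stop
     Stop Stop (Move LL 95))) Tip) (State 0 [] [1, 2] [1, 3] [1] 3 2, (Read (Read Stop (Move LL 68) Stop Stop)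
     (Move LL 69) Stop Stop)) (Node Tip (State 1 [] [1] [0, 3] [0, 2] 2 3, (Move UU 60)) Tip))"

definition view_table_3 :: "unit \<Rightarrow> (state \<times> tree) trie" where
  "view_table_3 _ =
     Node (Node (Node (Node Tip (State 1 [2] [] [] [0] 1 2, (Move UU 56)) Tip) (State 4 [] [] [4] [0, 4] 1 5, (Move
     UU 5)) Tip) (State 1 [] [1] [0] [] 2 2, (Move UL 58)) (Node Tip (State 1 [] [1, 3] [2, 5, 8] [3, 5] 4 6, (Move
     UL 115)) Tip)) (State 3 [] [] [0] [1] 1 3, (Move UL 35)) (Node (Node (Node Tip (State 2 [] [1, 2] [0, 1, 4]
     [1, 3] 3 5, (Move UL 158)) Tip) (State (- 3) [1, 2, 3, 4] [1] [1, 4] [1, 3] 3 5, (Read Stop (Move LL 103)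
     (Move UL 104) (Move LL 102))) Tip) (State 0 [] [1] [2] [1] 2 2, (Read (Read Stop Stop Stop (Move LL 18)) (Move
     LL 12) (Read Stop (Move LL 23) Stop (Move LL 19)) (Move LL 35))) (Node Tip (State 1 [] [1] [] [] 2 2, (Move UL
     58)) Tip))"

definition view_table_4 :: "unit \<Rightarrow> (state \<times> tree) trie" where
  "view_table_4 _ =
     Node (Node (Node (Node Tip (State 0 [] [1, 2] [4] [2] 3 3, (Read Stop (Move LL 29) (Read Stop (Move LL 77)
     Stop Stop) Stop)) Tip) (State (- 3) [1, 2, 3] [2] [0, 5] [0, 3] 3 4, (Read Stop (Move LU 79) Stop (Move LU
     155))) Tip) (State (- 1) [1, 2] [] [] [0] 1 2, (Read (Move UU 45) (Move LU 46) (Move UU 47) (Move LU 44)))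
     (Node Tip (State 4 [] [] [2] [1, 3] 1 5, (Move UL 18)) Tip)) (State 3 [] [] [1] [0, 2] 1 4, (Move UU 7)) (Node
     (Node (Node Tip (State 1 [] [1, 2] [0, 1, 5] [0, 3] 3 4, (Move UU 150)) Tip) (State (- 4) [1, 2, 3] [1, 3] [1,
     4, 7] [0, 2, 4] 4 5, (Read Stop Stop Stop (Move LU 92))) Tip) (State (- 2) [1, 2, 3] [] [1] [1] 2 3, (Read
     (Move UL 66) Stop Stop Stop)) (Node Tip (State 0 [] [3, 4] [3, 4, 7, 10] [2, 4, 6] 5 7, (Move LL 122)) Tip))"

definition view_table_5 :: "unit \<Rightarrow> (state \<times> tree) trie" where
  "view_table_5 _ =
     Node (Node (Node (Node Tip (State 0 [] [1, 2] [1] [] 3 2, (Read Stop (Move LL 143) Stop Stop)) Tip) (State (-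
     1) [2] [] [] [] 1 0, (Read (Read Stop (Move LL 87) Stop (Move LL 86)) Stop Stop Stop)) Tip) (State (- 2) [1,
     2] [] [0, 3] [0, 2] 2 3, (Read (Move UU 55) Stop Stop (Move LU 54))) (Node Tip (State (- 4) [1, 2, 3, 4] [3]
     [5, 8] [3, 5] 4 6, (Read Stop (Move LL 114) Stop Stop)) Tip)) (State 0 [] [1] [0, 1] [0] 2 1, (Move UU 33))
     (Node (Node (Node Tip (State (- 1) [] [1, 2] [3] [1] 3 2, (Read Stop (Move LL 64) Stop (Move LL 63))) Tip)
     (State (- 1) [] [1, 2] [1] [0] 3 2, (Read (Read Stop Stop Stop (Move LU 152)) (Move LU 101) (Read Stop (Move
     LU 153) Stop Stop) Stop)) Tip) (State 0 [] [1] [] [] 2 1, (Read (Read Stop (Move LL 29) Stop (Move LL 28))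
     (Move LL 17) Stop Stop)) (Node Tip (State 1 [] [2, 3] [1, 2, 5, 8] [1, 3, 5] 4 6, (Move UL 127)) Tip))"

definition view_table_6 :: "unit \<Rightarrow> (state \<times> tree) trie" where
  "view_table_6 _ =
     Node (Node (Node (Node Tip (State (- 2) [1, 2] [1] [0] [0] 2 2, (Read Stop Stop Stop (Move LU 138))) Tip)
     (State (- 3) [1, 2, 3] [1] [2, 5] [1, 3] 3 4, (Read (Move UL 82) (Move LL 99) Stop (Move LL 81))) Tip) (State
     (- 3) [1, 2] [1] [1, 4] [0, 2] 3 3, (Read (Move LU 51) (Move LU 129) (Move LU 142) (Move LU 50))) (Node Tip
     (State 1 [] [1, 3] [0, 2, 3] [0, 2] 4 5, (Move UU 110)) Tip)) (State (- 2) [1] [1] [1] [0] 2 1, (Read Stop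
     (Move LU 32) Stop (Move LU 25))) (Node (Node (Node Tip (State 0 [] [1, 2] [0, 4] [2] 3 3, (Move UL 154)) Tip)
     (State 0 [1, 2] [] [] [0] 1 2, (Read (Read Stop (Move LU 97) Stop Stop) Stop Stop Stop)) Tip) (State 0 [] [2]
     [1, 2] [1] 3 3, (Move LL 71)) (Node Tip (State 2 [] [1] [] [0] 2 3, (Move UU 124)) Tip))"

definition view_table_7 :: "unit \<Rightarrow> (state \<times> tree) trie" where
  "view_table_7 _ =
     Node (Node (Node (Node Tip (State (- 2) [1, 2, 3] [1] [1] [1] 2 3, (Read Stop (Move LL 146) Stop Stop)) Tip)
     (State 0 [2] [] [1] [1] 1 2, (Read (Read Stop Stop Stop (Move LL 88)) (Move LL 64) Stop Stop)) Tip) (State 1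
     [] [1] [0, 3] [2] 2 3, (Move UL 60)) (Node Tip (State 0 [] [1, 3] [1, 2] [1] 4 4, (Move LL 118)) Tip)) (State
     (- 2) [1, 2] [1] [2] [1] 2 2, (Read Stop (Move UL 38) Stop Stop)) (Node (Node (Node Tip (State 1 [] [1, 2] [0,
     3] [0, 2] 3 4, (Move UU 160)) Tip) (State (- 3) [1, 2, 3, 4] [] [6] [0, 4] 3 5, (Read (Move UU 106) Stop Stop
     Stop)) Tip) (State (- 2) [1, 2] [1] [0, 3] [0, 2] 2 3, (Read Stop Stop Stop (Move LU 59))) (Node Tip (State 1
     [] [1, 2] [5] [3] 3 4, (Move UL 130)) Tip))"

definition view_table_8 :: "unit \<Rightarrow> (state \<times> tree) trie" where
  "view_table_8 _ =
     Node (Node (Node (Node Tip (State (- 2) [1, 2, 3] [] [1, 4] [1, 3] 2 4, (Read (Move UL 132) Stop Stop Stop))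
     Tip) (State 1 [1] [] [0] [1] 1 3, (Move UL 1)) Tip) (State (- 1) [] [1] [0] [] 2 0, (Move UL 43)) (Node Tip
     (State 4 [] [] [1, 4] [2, 4] 1 5, (Move UL 29)) Tip)) (State 2 [] [] [1] [1] 1 2, (Move UL 21)) (Node (Node
     (Node Tip (State 1 [2] [] [0] [1] 1 3, (Move UL 149)) Tip) (State 0 [] [1, 3] [1, 2, 4] [0, 2] 4 4, (Move LU
     91)) Tip) (State (- 1) [] [1] [1] [0] 2 1, (Read (Read Stop Stop Stop (Move LU 65)) Stop Stop Stop)) (Node Tip
     (State 0 [] [2, 3] [1, 4, 7] [2, 4] 4 5, (Move LL 121)) Tip))"

definition view_table_9 :: "unit \<Rightarrow> (state \<times> tree) trie" where
  "view_table_9 _ =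
     Node (Node (Node (Node Tip (State (- 2) [] [1, 2, 3] [1, 4] [1] 4 2, (Read (Read Stop Stop Stop (Move LL 141))
     Stop Stop (Move LL 140))) Tip) (State 2 [1] [] [0, 3] [1, 3] 1 4, (Move UL 64)) Tip) (State (- 2) [1, 2] []
     [0] [0] 2 2, (Read (Move UU 53) Stop Stop Stop)) (Node Tip (State 1 [] [2, 3] [2, 5, 8] [3, 5] 4 6, (Move UL
     113)) Tip)) (State (- 1) [1, 2] [] [] [] 1 1, (Read (Move UL 30) (Move LL 31) (Move UL 40) Stop)) (Node (Node
     (Node Tip (State 2 [1] [] [3] [3] 1 4, (Move UL 101)) Tip) (State 1 [] [1, 2] [0, 2, 5] [1, 3] 3 4, (Move UL
     100)) Tip) (State 0 [2] [] [0] [0] 1 1, (Move UU 74)) (Node Tip (State 1 [] [1, 2] [2, 5] [1, 3] 3 4, (Move UL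
     100)) Tip))"

definition view_table_10 :: "unit \<Rightarrow> (state \<times> tree) trie" where
  "view_table_10 _ =
     Node (Node (Node (Node Tip (State (- 1) [] [1, 2, 3] [0, 2, 5] [0, 2] 4 3, (Move UU 137)) Tip) (State 3 [] []
     [2] [0, 2] 1 3, (Move UU 17)) Tip) (State 0 [] [1] [0, 2] [1] 2 2, (Move UL 49)) (Node Tip (State 1 [1] [] [2]
     [2] 1 3, (Move UL 16)) Tip)) (State 1 [] [] [0] [0] 1 1, (Move UU 9)) (Node (Node (Node Tip (State 0 [2] [] []
     [0] 1 2, (Read (Read Stop Stop Stop (Move LU 152)) Stop (Read Stop (Move LU 153) Stop Stop) Stop)) Tip) (State
     (- 4) [1, 2, 3] [1, 3] [2] [1] 4 4, (Read Stop (Move LL 96) Stop Stop)) Tip) (State (- 3) [1, 2] [2] [4] [2] 3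
     3, (Read Stop (Move LL 70) Stop (Move LL 136))) (Node Tip (State 1 [] [] [] [] 1 0, (Move UL 123)) Tip))"

definition view_table_11 :: "unit \<Rightarrow> (state \<times> tree) trie" where
  "view_table_11 _ =
     Node (Node (Node (Node Tip (State 2 [2] [] [1] [0, 2] 1 4, (Move UU 145)) Tip) (State 4 [] [] [4] [1, 4] 1 5,
     (Move UL 23)) Tip) (State (- 2) [1, 2] [1] [3] [2] 2 3, (Read Stop Stop Stop (Move LL 59))) (Node Tip (State 2
     [] [1] [1, 4] [1, 3] 2 4, (Move UL 116)) Tip)) (State 3 [] [] [0, 3] [1, 3] 1 4, (Move UL 12)) (Node (Node
     (Node Tip (State 1 [] [1, 2] [0, 2] [1] 3 3, (Move UL 159)) Tip) (State (- 3) [1, 2, 3, 4] [2] [6] [0, 4] 3 5,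
     (Read Stop (Move LU 105) Stop Stop)) Tip) (State 0 [] [1, 2] [1, 4] [2] 3 3, (Read Stop (Move LL 29) (Read
     Stop (Move LL 77) Stop Stop) (Move LL 28))) (Node Tip (State 1 [] [1] [3] [2] 2 3, (Move UL 60)) Tip))"

definition view_table_12 :: "unit \<Rightarrow> (state \<times> tree) trie" where
  "view_table_12 _ =
     Node (Node (Node (Node Tip (State (- 1) [] [2, 3] [0, 3, 6] [1, 3] 4 4, (Move LL 133)) Tip) (State 1 [] [1, 2]
     [0, 1, 3] [0, 2] 3 4, (Move UU 80)) Tip) (State 2 [] [] [] [0] 1 2, (Move UU 6)) (Node Tip (State 0 [] [1, 3]
     [1, 2, 4, 7] [0, 2, 4] 4 5, (Move LU 109)) Tip)) (State 3 [] [] [] [0] 1 3, (Move UU 2)) (Node (Node (Node Tip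
     (State (- 4) [1, 2, 3, 4] [1, 3] [2, 5, 8] [1, 3, 5] 4 6, (Read Stop Stop Stop (Move LL 151))) Tip) (State (-
     4) [1, 2, 3] [1] [2] [1] 4 4, (Read (Move LL 93) (Move LL 94) Stop Stop)) Tip) (State (- 2) [1, 2, 3] [1] [1,
     4] [1, 3] 2 4, (Read Stop Stop Stop (Move LL 67))) (Node Tip (State 0 [] [1, 3] [1, 4, 7] [2, 4] 4 5, (Move LL
     109)) Tip))"

definition view_table_13 :: "unit \<Rightarrow> (state \<times> tree) trie" where
  "view_table_13 _ =
     Node (Node (Node (Node Tip (State (- 4) [1, 2, 3] [1, 3] [1, 6] [0, 3] 4 4, (Read Stop (Move LU 144) Stop
     Stop)) Tip) (State 4 [] [] [2] [0, 3] 1 5, (Move UU 3)) Tip) (State (- 2) [] [1] [] [] 2 (- 1), (Read (Read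
     Stop (Move LU 78) Stop (Move LU 56)) Stop (Read Stop (Move LL 57) Stop Stop) Stop)) (Node Tip (State 1 [] [1,
     3] [2, 3, 8] [2, 5] 4 6, (Move UL 111)) Tip)) (State (- 2) [1] [1] [2] [1] 2 2, (Read Stop Stop Stop (Move LL
     34))) (Node (Node (Node Tip (State 0 [] [2, 3] [2, 4] [2] 4 4, (Move LL 157)) Tip) (State 2 [] [1] [1] [1] 2
     3, (Move UL 71)) Tip) (State 0 [] [1, 2] [1, 2] [1] 3 3, (Read (Read Stop Stop Stop (Move LL 75)) (Move LL 23)
     (Read Stop (Move LL 76) Stop Stop) (Move LL 19))) (Node Tip (State 0 [] [] [] [] 1 (- 1), (Read (Read Stop
     (Move LU 17) Stop Stop) Stop Stop Stop)) Tip))"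

definition view_table_14 :: "unit \<Rightarrow> (state \<times> tree) trie" where
  "view_table_14 _ =
     Node (Node (Node (Node Tip (State (- 4) [1, 2, 3] [2] [2, 5] [1, 3] 4 5, (Read Stop Stop (Move LL 104) Stop))
     Tip) (State 1 [] [1] [0] [0] 2 2, (Move UU 58)) Tip) (State 0 [] [1] [1] [0] 2 1, (Read (Read Stop (Move LU
     29) Stop (Move LU 28)) Stop Stop Stop)) (Node Tip (State 1 [] [1, 3] [0, 2, 3, 8] [0, 2, 5] 4 6, (Move UU
     111)) Tip)) (State 3 [] [] [3] [0, 3] 1 4, (Move UU 4)) (Node (Node (Node Tip (State 0 [] [1, 3, 4] [1, 3, 4,
     7] [0, 2, 4] 5 6, (Move LU 156)) Tip) (State 0 [1, 2] [] [2] [0, 2] 1 3, (Read (Read Stop Stop Stop (Move LU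
     98)) Stop Stop Stop)) Tip) (State (- 3) [1, 2] [2] [2, 5] [1, 3] 3 4, (Read Stop Stop Stop (Move LL 72)))
     (Node Tip (State 2 [] [1] [4] [0, 3] 2 4, (Move UU 125)) Tip))"

definition view_table_15 :: "unit \<Rightarrow> (state \<times> tree) trie" where
  "view_table_15 _ =
     Node (Node (Node (Node Tip (State 3 [] [] [2] [2] 1 3, (Move UL 17)) Tip) (State 0 [] [2, 3] [2, 4, 7] [2, 4]
     4 5, (Move LL 89)) Tip) (State (- 2) [1, 2] [1] [] [] 2 2, (Read Stop (Move LL 61) Stop Stop)) (Node Tip
     (State 0 [] [1, 3] [1, 2, 7] [1, 4] 4 5, (Move LL 119)) Tip)) (State 1 [] [1] [0, 2] [1] 2 2, (Move UL 39))
     (Node (Node (Node Tip (State 0 [] [1, 2] [1] [0] 3 2, (Read (Read Stop (Move LU 97) Stop Stop) Stop Stop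
     Stop)) Tip) (State (- 3) [1, 2, 3, 4] [1] [4] [0, 3] 3 5, (Read Stop (Move LU 107) Stop Stop)) Tip) (State 1
     [1] [] [] [0] 1 2, (Move UU 15)) (Node Tip (State 0 [] [2, 3] [0, 1, 4, 7] [0, 2, 4] 4 5, (Move UU 131)) Tip))"

definition view_table :: "(state \<times> tree) trie" where
  "view_table =
     Node (Node (Node (Node (Delay view_table_0) (State 1 [] [] [1] [1] 1 2, (Move UL 11)) (Delay view_table_1))
     (State 2 [] [] [2] [2] 1 3, (Move UL 8)) (Node (Delay view_table_2) (State 2 [] [] [2] [0, 2] 1 3, (Move UU
     8)) (Delay view_table_3))) (State 2 [] [] [] [] 1 2, (Move UL 6)) (Node (Node (Delay view_table_4) (State 1 []
     [] [] [0] 1 2, (Move UU 13)) (Delay view_table_5)) (State 1 [] [] [] [] 1 1, (Move UL 9)) (Node (Delay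
     view_table_6) (State (- 1) [] [] [] [] 1 0, (Read (Read Stop Stop Stop (Move LL 1)) (Move LL 24) (Read Stop
     (Move LL 16) Stop (Move LL 15)) (Move LL 20))) (Delay view_table_7)))) (State 0 [1] [] [] [0] 1 2, (Read (Read
     Stop Stop Stop (Move LU 3)) (Move LU 4) (Read Stop (Move LU 5) Stop Stop) (Move LU 2))) (Node (Node (Node
     (Delay view_table_8) (State 0 [] [] [] [] 1 0, (Read (Read Stop (Move LL 12) Stop (Move LL 35)) (Move LL 21)
     (Read Stop (Move LL 17) Stop Stop) (Move LL 117))) (Delay view_table_9)) (State 3 [] [] [3] [3] 1 4, (Move UL
     4)) (Node (Delay view_table_10) (State 0 [] [] [] [] 1 1, (Read (Read Stop Stop Stop (Move LL 7)) (Move LL 8)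
     (Read Stop (Move LL 4) Stop (Move LL 2)) (Move LL 6))) (Delay view_table_11))) (State 3 [] [] [1] [2] 1 4,
     (Move UL 7)) (Node (Node (Delay view_table_12) (State 0 [] [] [0] [0] 1 1, (Move UU 14)) (Delay
     view_table_13)) (State 2 [] [] [0] [1] 1 3, (Move UL 10)) (Node (Delay view_table_14) (State 0 [1] [] [] [] 1
     1, (Read (Read Stop (Move LL 29) Stop (Move LL 28)) (Move LL 17) Stop Stop)) (Delay view_table_15))))"

text \<open>
  For each memory state, the pairs of automaton states that can occur with it at the reading head and
  at the writing head. They are grouped by the state at the reading head.
\<close>
definition link_table_0 :: "unit \<Rightarrow> (int \<times> int list) list trie" where
  "link_table_0 _ =
     Node (Node (Node (Node Tip [(32, [189]), (373, [368])] Tip) [(91, [15, 30]), (96, [15]), (122, [38]), (156,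
     [57]), (173, [57]), (201, [15, 30]), (224, [110])] Tip) [(49, [235, 378]), (58, [252]), (66, [7]), (91, [248,
     252, 317]), (96, [125, 252, 317]), (185, [125, 358]), (204, [317]), (228, [125, 248, 252, 317]), (284, [125,
     252]), (351, [125]), (371, [248, 252])] (Node (Node Tip [(372, [80])] Tip) [(236, [69])] Tip)) [(8, [349]),
     (12, [64, 158, 166]), (23, [1]), (49, [251]), (53, [152, 203]), (91, [24, 45]), (96, [24]), (99, [269]), (122,
     [56]), (148, [365]), (156, [80]), (173, [80]), (179, [365]), (184, [179]), (201, [24, 45]), (224, [149]),
     (267, [166, 224]), (283, [179]), (288, [271, 357]), (293, [64, 158, 269, 271]), (306, [166]), (325, [240]),
     (342, [64, 271]), (352, [64, 271, 357]), (363, [251])] (Node (Node (Node Tip [(364, [70])] Tip) [(146, [72]),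
     (254, [72]), (372, [72])] Tip) [(44, [8]), (105, [8]), (120, [8, 18, 127]), (297, [8, 18]), (324, [18])] (Node
     Tip [(314, [137])] Tip))"

definition link_table_1 :: "unit \<Rightarrow> (int \<times> int list) list trie" where
  "link_table_1 _ =
     Node (Node (Node (Node Tip [(321, [344])] Tip) [(152, [31])] Tip) [(83, [293])] (Node Tip [(279, [99, 380])]
     Tip)) [(20, [152]), (25, [64, 160, 166, 172, 251, 316, 339]), (29, [1]), (75, [1]), (86, [166, 172, 360]),
     (122, [254]), (208, [64, 166, 172, 271]), (234, [343]), (258, [1]), (302, [160, 166, 172]), (308, [1, 338]),
     (333, [359]), (362, [354])] (Node (Node (Node Tip [(6, [298]), (323, [140])] Tip) [(160, [38]), (172, [38])]
     Tip) [(84, [26]), (97, [26]), (247, [367])] (Node Tip [(314, [175])] Tip))"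

definition link_table_2 :: "unit \<Rightarrow> (int \<times> int list) list trie" where
  "link_table_2 _ =
     Node (Node (Node (Node Tip [(337, [363])] Tip) [(150, [177])] Tip) [(44, [4]), (105, [4]), (120, [4, 11, 89]),
     (297, [4, 11]), (324, [11])] (Node Tip [(185, [139]), (228, [139]), (276, [46])] Tip)) [(15, [1]), (27, [166,
     172]), (30, [1]), (44, [160]), (105, [166, 254, 316, 339]), (107, [240, 309, 343]), (110, [365]), (123,
     [254]), (126, [64, 166]), (142, [243, 343]), (192, [64, 271]), (194, [240]), (197, [172, 240, 343]), (212,
     [160, 240]), (231, [64, 256, 271]), (247, [260]), (249, [172]), (297, [172, 243, 251, 254]), (299, [240]),
     (303, [166]), (334, [160, 172])] (Node (Node (Node Tip [(92, [377])] Tip) [(189, [47])] Tip) [(116, [138])]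
     (Node Tip [(216, [52]), (275, [46])] Tip))"

definition link_table_3 :: "unit \<Rightarrow> (int \<times> int list) list trie" where
  "link_table_3 _ =
     Node (Node (Node (Node Tip [(247, [353])] Tip) [(18, [28, 33]), (215, [33]), (267, [112]), (314, [33])] Tip)
     [(5, [11]), (90, [11]), (155, [11]), (191, [11]), (200, [11])] (Node Tip [(275, [11])] Tip)) [(15, [28]), (73,
     [191]), (79, [210, 218]), (82, [178]), (171, [34]), (175, [210]), (192, [73]), (281, [104])] (Node (Node (Node
     Tip [(372, [176])] Tip) [(240, [70])] Tip) [(3, [18]), (88, [18]), (216, [74]), (274, [66]), (275, [68]),
     (278, [262])] (Node Tip [(280, [221])] Tip))"

definition link_table_4 :: "unit \<Rightarrow> (int \<times> int list) list trie" where
  "link_table_4 _ =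
     Node (Node (Node (Node Tip [(314, [262])] Tip) [(147, [49, 363]), (181, [49, 363]), (255, [49, 363]), (289,
     [49])] Tip) [(1, [6]), (64, [6]), (158, [6]), (203, [323]), (354, [6]), (357, [6, 323])] (Node Tip [(148,
     [83]), (240, [178]), (339, [61])] Tip)) [(31, [90, 200, 210]), (148, [116]), (163, [30]), (166, [36, 67]),
     (172, [36]), (203, [79]), (240, [223]), (243, [112]), (260, [112]), (269, [97, 225]), (339, [85]), (344, [90,
     210]), (380, [292])] (Node (Node (Node Tip [(179, [326])] Tip) [(193, [48])] Tip) [(107, [32, 345]), (142,
     [345, 373]), (212, [32, 345]), (249, [32])] (Node Tip [(313, [136])] Tip))"

definition link_table_5 :: "unit \<Rightarrow> (int \<times> int list) list trie" where
  "link_table_5 _ =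
     Node (Node (Node (Node Tip [(101, [214])] Tip) [(85, [39])] Tip) [(81, [12, 293])] (Node Tip [(277, [98])]
     Tip)) [(40, [210, 218]), (46, [5]), (239, [90, 210]), (331, [210])] (Node (Node (Node Tip [(179, [78])] Tip)
     [(146, [102]), (254, [102]), (372, [102])] Tip) [(5, [18]), (90, [18]), (114, [51]), (142, [74]), (155, [18]),
     (191, [18]), (194, [74]), (200, [18]), (280, [262])] (Node Tip [(313, [174])] Tip))"

definition link_table_6 :: "unit \<Rightarrow> (int \<times> int list) list trie" where
  "link_table_6 _ =
     Node (Node (Node (Node Tip [(71, [168, 274])] Tip) [(154, [31]), (170, [31]), (228, [31, 344])] Tip) [(76,
     [20]), (102, [259]), (167, [20, 320]), (182, [20, 320]), (272, [320]), (290, [362]), (341, [20]), (364, [20])]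
     (Node Tip [(280, [100])] Tip)) [(24, [3]), (39, [209]), (45, [3]), (65, [202]), (145, [209, 283, 291]), (147,
     [278, 336]), (149, [336]), (162, [283]), (164, [88, 209]), (181, [278, 283]), (241, [278]), (244, [209, 278]),
     (245, [209, 283, 291]), (255, [202, 278]), (270, [88]), (287, [300]), (289, [209]), (327, [278]), (356, [202,
     209])] (Node (Node (Node Tip [(179, [350])] Tip) [(144, [59])] Tip) [(114, [21])] (Node Tip [(280, [175])]
     Tip))"

definition link_table_7 :: "unit \<Rightarrow> (int \<times> int list) list trie" where
  "link_table_7 _ =
     Node (Node (Node (Node Tip [(140, [298])] Tip) [(96, [26]), (370, [26])] Tip) [(3, [11]), (88, [11])] (Node
     Tip [(280, [137])] Tip)) [(54, [12]), (72, [274]), (130, [12, 288, 293, 352]), (143, [12, 288, 293]), (233,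
     [352]), (250, [342]), (315, [12]), (346, [293])] (Node (Node (Node Tip [(372, [57])] Tip) [(238, [69])] Tip)
     [(93, [12]), (129, [288, 293, 342]), (134, [12, 293, 342]), (193, [12, 288, 293, 342, 352]), (318, [12, 293])]
     (Node Tip [(314, [221])] Tip))"

definition link_table_8 :: "unit \<Rightarrow> (int \<times> int list) list trie" where
  "link_table_8 _ =
     Node (Node (Node (Node Tip [(310, [345])] Tip) [(1, [14]), (6, [325]), (160, [56]), (172, [56]), (323, [179]),
     (338, [14])] Tip) [(40, [9, 128]), (46, [9]), (239, [128]), (331, [128])] (Node Tip [(182, [178]), (229,
     [83]), (364, [178])] Tip)) [(22, [90]), (52, [192]), (57, [27, 210, 218]), (114, [30]), (139, [296]), (155,
     [222]), (223, [366]), (238, [30]), (246, [30]), (253, [303]), (263, [61]), (296, [200]), (376, [67])] (Node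
     (Node (Node Tip [(360, [367])] Tip) [(142, [22]), (194, [22])] Tip) [(25, [8, 18, 314]), (273, [18])] (Node
     Tip [(276, [18])] Tip))"

definition link_table_9 :: "unit \<Rightarrow> (int \<times> int list) list trie" where
  "link_table_9 _ =
     Node (Node (Node (Node Tip [(313, [329])] Tip) [(156, [38]), (173, [38])] Tip) [(82, [12, 293, 352]), (94,
     [12]), (142, [12, 288, 293]), (249, [342])] (Node Tip [(276, [11])] Tip)) [(36, [7]), (50, [235]), (59,
     [252]), (67, [7]), (92, [125, 248, 252, 328]), (187, [358]), (205, [317]), (281, [125]), (285, [125, 248,
     252]), (321, [252])] (Node (Node (Node Tip [(8, [298]), (267, [140])] Tip) [(185, [101]), (228, [101])] Tip)
     [(85, [27])] (Node Tip [(276, [30])] Tip))"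

definition link_table_10 :: "unit \<Rightarrow> (int \<times> int list) list trie" where
  "link_table_10 _ =
     Node (Node (Node (Node Tip [(313, [301])] Tip) [(155, [177])] Tip) [(25, [4, 11, 279]), (273, [11])] (Node Tip
     [(8, [325]), (184, [140]), (267, [179]), (283, [140])] Tip)) [(15, [194]), (22, [114]), (42, [126, 231, 247]),
     (52, [239]), (55, [194, 249]), (57, [40, 253]), (114, [44, 46]), (139, [324]), (144, [197]), (155, [263]),
     (220, [231]), (223, [376]), (238, [46]), (239, [123, 197, 212]), (246, [46]), (253, [44, 120, 126, 231, 331]),
     (263, [85]), (264, [385]), (296, [246]), (324, [239]), (376, [95, 197])] (Node (Node (Node Tip [(360, [259])]
     Tip) [(190, [47])] Tip) [(115, [19]), (132, [19]), (181, [19, 319]), (289, [319])] (Node Tip [(177, [27])]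
     Tip))"

definition link_table_11 :: "unit \<Rightarrow> (int \<times> int list) list trie" where
  "link_table_11 _ =
     Node (Node (Node (Node Tip [(360, [353])] Tip) [(23, [28, 303])] Tip) [(2, [10]), (368, [10])] (Node Tip
     [(216, [34]), (275, [30])] Tip)) [(16, [30]), (29, [28, 303]), (62, [191]), (78, [210, 218, 280]), (91, [28,
     303]), (102, [292]), (108, [34]), (150, [222]), (165, [30]), (167, [36, 67]), (182, [223]), (228, [104]),
     (229, [116]), (242, [30]), (276, [30]), (307, [187]), (364, [223]), (383, [28])] (Node (Node (Node Tip [(285,
     [101]), (321, [101])] Tip) [(237, [69])] Tip) [(8, [17]), (127, [17]), (245, [17]), (379, [17])] (Node Tip
     [(274, [45]), (278, [221])] Tip))"

definition link_table_12 :: "unit \<Rightarrow> (int \<times> int list) list trie" where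
  "link_table_12 _ =
     Node (Node (Node (Node Tip [(313, [261])] Tip) [(146, [50]), (254, [50]), (372, [50])] Tip) [(15, [27, 42]),
     (36, [82, 123, 281]), (73, [120, 238]), (79, [253]), (82, [223]), (84, [82, 84, 92, 144, 197, 205, 285]), (92,
     [94, 107]), (104, [84, 385]), (105, [187]), (112, [84]), (126, [30]), (138, [90, 200, 210]), (171, [52]),
     (175, [253]), (192, [42, 92, 97]), (197, [112]), (225, [375]), (231, [225]), (239, [97, 107]), (246, [104]),
     (247, [36, 67]), (281, [144]), (285, [197, 334]), (301, [285]), (321, [107, 299]), (353, [107]), (366, [84]),
     (377, [82]), (385, [171, 285])] (Node Tip [(216, [22])] Tip)) [(13, [30]), (33, [90, 200, 210]), (101, [292]),
     (175, [210]), (210, [33]), (218, [33]), (257, [94]), (280, [33])] (Node (Node (Node Tip [(361, [99])] Tip)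
     [(191, [47])] Tip) [(106, [32]), (211, [32, 345]), (361, [32])] (Node Tip [(275, [18])] Tip))"

definition link_table_13 :: "unit \<Rightarrow> (int \<times> int list) list trie" where
  "link_table_13 _ =
     Node (Node (Node (Node Tip [(346, [48])] Tip) [(6, [33]), (17, [28])] Tip) [(40, [16, 165]), (46, [16]), (239,
     [165]), (331, [165])] (Node Tip [(274, [11])] Tip)) [(37, [2]), (43, [2]), (119, [2]), (161, [295]), (330,
     [2]), (335, [2, 295])] (Node (Node (Node Tip [(285, [71]), (321, [71])] Tip) [(142, [34]), (194, [34])] Tip)
     [(6, [17]), (131, [21]), (166, [21]), (172, [21]), (240, [21]), (343, [21]), (378, [17])] (Node Tip [(177,
     [40])] Tip))"

definition link_table_14 :: "unit \<Rightarrow> (int \<times> int list) list trie" where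
  "link_table_14 _ =
     Node (Node (Node (Node Tip [(359, [374])] Tip) [(114, [33]), (142, [52]), (194, [52])] Tip) [(55, [22]), (95,
     [22])] (Node Tip [(278, [100])] Tip)) [(12, [30, 303]), (23, [27, 42, 331]), (53, [5]), (168, [28, 33]), (209,
     [33]), (278, [33]), (306, [187]), (342, [225])] (Node (Node (Node Tip [(372, [138])] Tip) [(157, [59])] Tip)
     [(113, [19])] (Node Tip [(274, [30]), (278, [175])] Tip))"

definition link_table_15 :: "unit \<Rightarrow> (int \<times> int list) list trie" where
  "link_table_15 _ =
     Node (Node (Node (Node Tip [(139, [257])] Tip) [(185, [71]), (228, [71])] Tip) [(4, [10]), (89, [10]), (199,
     [10]), (369, [10])] (Node Tip [(274, [18]), (278, [137])] Tip)) [(55, [13]), (95, [13])] (Node (Node (Node Tip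
     [(285, [139]), (321, [139])] Tip) [(235, [69])] Tip) [(92, [15, 30]), (225, [110]), (366, [30])] (Node Tip
     [(313, [220])] Tip))"

definition link_table :: "(int \<times> int list) list trie" where
  "link_table =
     Node (Node (Node (Node (Delay link_table_0) [(3, [53, 215]), (8, [75, 258]), (12, [58, 66]), (16, [65, 68,
     145, 159, 164, 245, 270]), (18, [29, 75, 86, 88, 184, 186, 258, 308, 333]), (20, [128]), (23, [58, 87, 370]),
     (25, [45, 266]), (29, [63, 355]), (48, [236, 251, 379]), (53, [16]), (62, [159, 164, 270, 277]), (75, [195,
     237]), (76, [241, 289]), (78, [294]), (87, [130, 143]), (88, [18, 127, 245, 260]), (91, [63, 65, 159, 270,
     355]), (96, [132, 181, 356]), (102, [294]), (103, [117, 386]), (108, [74, 315, 346]), (127, [29]), (150, [245,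
     304]), (154, [181]), (156, [145, 147, 181, 241, 244, 255, 327]), (165, [65, 68, 159, 270]), (167, [77, 115,
     133, 181]), (168, [62]), (182, [181, 244, 305]), (184, [314]), (186, [18, 180, 381]), (188, [244]), (202,
     [148, 267]), (206, [18, 127, 131]), (209, [18, 62, 127, 146, 148, 314]), (215, [29, 86, 186]), (224, [381]),
     (226, [18, 215]), (228, [183]), (229, [143, 195]), (242, [68, 117, 183, 270]), (259, [115, 132, 181]), (262,
     [65, 159, 245]), (267, [29, 234, 258]), (276, [68]), (278, [18, 62, 180, 314]), (283, [18, 148, 215, 314]),
     (284, [244]), (291, [18, 148]), (300, [18, 148]), (306, [272]), (307, [77, 145]), (308, [128, 145]), (313,
     [135]), (314, [29, 86, 226]), (320, [128]), (322, [117, 130, 143]), (332, [346]), (333, [128]), (336, [18,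
     215, 267]), (341, [145]), (342, [307]), (349, [245]), (362, [128]), (364, [115, 181, 305]), (383, [63]), (384,
     [245])] (Delay link_table_1)) [(3, [35, 169]), (8, [53, 215]), (12, [39, 45]), (18, [18, 53, 62, 64, 127, 146,
     148, 158, 215, 267, 269, 271, 306, 314, 357]), (23, [39, 63, 355]), (48, [190, 369]), (53, [9]), (88, [11, 89,
     199]), (127, [18]), (168, [41, 51]), (184, [279]), (186, [11]), (202, [109, 227]), (206, [11, 89]), (209, [11,
     51, 89, 109, 279]), (215, [18, 62, 148, 314]), (226, [11, 169]), (267, [18, 188, 215, 314]), (278, [11, 51,
     279]), (283, [11, 169, 279]), (291, [11]), (300, [11]), (306, [233]), (314, [18, 62, 180, 314]), (336, [11,
     169, 227]), (342, [266])] (Node (Delay link_table_2) [(16, [44, 46, 105, 120, 126, 231, 297]), (20, [90, 200,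
     210]), (25, [30, 225]), (29, [42, 331]), (62, [120, 126, 231, 238]), (75, [155, 191]), (76, [194, 249]), (78,
     [253]), (87, [92, 285]), (91, [42, 44, 120, 231, 331]), (96, [94, 142, 334]), (102, [253]), (103, [84, 385]),
     (108, [52, 281, 321]), (150, [263, 297]), (154, [142]), (156, [105, 107, 142, 194, 197, 212, 299]), (165, [44,
     46, 120, 231]), (167, [55, 82, 95, 142]), (182, [142, 197, 264]), (186, [375]), (188, [197]), (224, [375]),
     (228, [144]), (229, [155, 285]), (242, [46, 84, 144, 231]), (259, [82, 94, 142]), (262, [44, 120, 297]), (276,
     [46]), (284, [197]), (307, [55, 105]), (308, [105, 210]), (313, [97]), (320, [90, 210]), (322, [84, 92, 285]),
     (332, [321]), (333, [210]), (341, [105]), (349, [280]), (362, [90, 210]), (364, [82, 142, 264]), (383, [42]),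
     (384, [297])] (Delay link_table_3))) [(5, [35, 169]), (13, [45]), (22, [190]), (33, [128]), (90, [11]), (101,
     [221]), (175, [128, 251]), (210, [11, 51, 89]), (218, [51, 109, 279]), (257, [132]), (280, [11, 51, 279]),
     (292, [11]), (375, [169, 227])] (Node (Node (Delay link_table_4) [(6, [29, 75, 86, 184, 186, 258, 308]), (17,
     [86, 88, 308]), (31, [165]), (69, [275, 291]), (136, [88]), (148, [150]), (163, [66]), (166, [76]), (172,
     [76]), (203, [150]), (240, [103]), (243, [188]), (260, [188]), (269, [173, 307]), (323, [29, 75]), (339,
     [157]), (344, [165]), (380, [262])] (Delay link_table_5)) [(5, [53, 215]), (13, [66]), (15, [39, 63]), (22,
     [236, 251]), (28, [158, 163, 357]), (33, [165]), (36, [115, 162, 315]), (73, [159, 277]), (79, [294]), (82,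
     [74]), (84, [115, 117, 130, 143, 183, 244, 250]), (90, [18]), (92, [132, 147]), (101, [262]), (104, [117,
     386]), (105, [233]), (112, [117]), (126, [45]), (138, [128]), (155, [180]), (171, [74]), (174, [163]), (175,
     [165, 291, 294]), (192, [63, 130, 135]), (197, [151]), (210, [18, 62, 127, 146, 260]), (218, [62, 146, 148,
     314]), (225, [381]), (231, [266]), (239, [135, 147]), (246, [143]), (247, [54]), (257, [170]), (280, [18, 62,
     180, 314]), (281, [183]), (285, [244, 356]), (292, [18]), (301, [143]), (321, [147, 327]), (353, [147]), (366,
     [117]), (375, [215, 267]), (377, [115]), (385, [143, 217])] (Node (Delay link_table_6) [(3, [43]), (8, [37]),
     (12, [113]), (16, [129, 134]), (18, [37]), (20, [207]), (23, [113, 161]), (25, [93, 219]), (29, [121]), (48,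
     [230]), (53, [37]), (62, [129, 134, 340]), (75, [282, 312]), (76, [193]), (78, [347]), (87, [211]), (88, [43,
     129]), (91, [121, 129, 134]), (96, [193]), (102, [347]), (103, [196]), (108, [141, 361]), (127, [37]), (150,
     [129, 282]), (154, [193]), (156, [134, 193, 318]), (165, [129, 134]), (167, [121, 193]), (168, [119]), (182,
     [193, 268, 318]), (184, [43]), (186, [43, 129]), (188, [318]), (202, [232, 335]), (206, [43, 213]), (209, [43,
     119, 230, 232]), (215, [37]), (224, [129]), (226, [43]), (228, [268]), (229, [211, 282]), (242, [134, 196,
     268]), (259, [193]), (262, [129]), (267, [37, 311]), (276, [134]), (278, [43, 119, 129]), (283, [43, 232]),
     (284, [318]), (291, [43, 232]), (300, [43, 232]), (306, [337]), (307, [121, 134]), (308, [134, 207]), (313,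
     [219]), (314, [37]), (320, [207]), (322, [196, 211]), (332, [361]), (333, [207]), (336, [43, 335]), (341,
     [134]), (342, [330]), (349, [129]), (362, [207]), (364, [193, 268]), (383, [121]), (384, [129])] (Delay
     link_table_7)))) [(1, [23, 131, 260]), (6, [349]), (31, [152]), (64, [160, 316, 339]), (146, [240]), (148,
     [343]), (160, [78, 180, 254, 372]), (163, [64, 166]), (166, [64, 160, 166, 172, 271]), (172, [78, 240]), (180,
     [166, 243, 316]), (240, [240, 309]), (243, [172, 240, 343]), (251, [166, 172]), (254, [160, 240, 309, 343]),
     (256, [158]), (260, [160, 172]), (269, [64, 160, 271]), (271, [64, 166]), (309, [254, 316, 372]), (316, [172,
     243, 309]), (323, [224]), (338, [23]), (339, [172]), (343, [343]), (344, [354]), (357, [172, 251]), (360,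
     [260]), (365, [243, 254]), (372, [172, 240, 309])] (Node (Node (Node (Delay link_table_8) [(5, [75, 258]),
     (13, [81]), (15, [58, 87, 241]), (22, [153, 275, 291]), (28, [88, 206]), (33, [208]), (36, [154, 204, 341]),
     (42, [164, 270, 287]), (52, [60]), (55, [241, 289]), (57, [60, 294]), (73, [201, 313]), (79, [322]), (82,
     [103]), (84, [154, 156, 167, 182, 229, 284, 290]), (90, [29]), (92, [170, 185]), (101, [302]), (104, [156]),
     (105, [272]), (112, [156]), (114, [65, 68]), (126, [66]), (138, [165]), (139, [348]), (144, [244]), (155,
     [226, 304]), (171, [103]), (174, [206]), (175, [208, 322]), (192, [87, 167, 173]), (197, [188]), (210, [29,
     86, 184, 300]), (218, [29, 86, 184, 186]), (220, [270]), (223, [382]), (225, [384]), (231, [307]), (238,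
     [68]), (239, [162, 173, 185, 244, 255]), (246, [68, 182]), (247, [76]), (253, [65, 159, 164, 270, 355]), (257,
     [216]), (263, [118]), (264, [386]), (280, [29, 86, 226]), (281, [229]), (285, [284, 371]), (292, [29]), (296,
     [286]), (301, [182]), (321, [185, 351]), (324, [60]), (353, [185]), (366, [156]), (375, [258, 308]), (376,
     [133, 244]), (377, [154]), (385, [182, 259])] (Delay link_table_9)) [(8, [35, 169]), (18, [11, 35, 41, 51, 89,
     109, 169, 227, 265, 279]), (127, [11]), (215, [11, 51, 279]), (267, [11, 151, 169, 279]), (314, [11, 51,
     279])] (Node (Delay link_table_10) [(6, [43, 119, 230, 232, 335]), (17, [119, 124, 335]), (31, [207]), (69,
     [230]), (136, [124]), (148, [141]), (163, [93]), (166, [106]), (172, [106]), (203, [141]), (240, [141]), (243,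
     [198]), (260, [198]), (269, [219]), (323, [43]), (339, [198]), (344, [207]), (380, [207])] (Delay
     link_table_11))) [(6, [11, 35, 51, 89, 109, 169, 227, 279]), (17, [41, 227]), (69, [190]), (323, [11, 35,
     279])] (Node (Node (Delay link_table_12) [(3, [75, 258]), (8, [25]), (12, [81]), (16, [91, 96, 201]), (18,
     [25]), (20, [165]), (23, [81, 122]), (25, [66, 307]), (29, [87, 370]), (48, [275, 291, 383]), (53, [25]), (62,
     [96, 201, 313]), (75, [242, 276]), (76, [228]), (78, [322]), (87, [167, 182]), (88, [29, 91, 300]), (91, [87,
     91, 96, 201, 370]), (96, [170, 228, 371]), (102, [322]), (103, [156]), (108, [103, 341, 364]), (127, [25]),
     (150, [91, 242]), (154, [228]), (156, [96, 185, 228, 284, 351]), (165, [91, 96, 201]), (167, [108, 154, 228]),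
     (168, [86]), (182, [228, 284, 332]), (184, [29]), (186, [29, 226, 384]), (188, [284]), (202, [186, 308]),
     (206, [29, 168]), (209, [29, 86, 184, 186]), (215, [25]), (224, [384]), (226, [29, 258]), (228, [229]), (229,
     [182, 242]), (242, [96, 156, 229]), (259, [154, 170, 228]), (262, [91, 201]), (267, [25, 273]), (276, [96]),
     (278, [29, 86, 226]), (283, [29, 186, 258]), (284, [284]), (291, [29, 186]), (300, [29, 186]), (306, [310]),
     (307, [96, 108]), (308, [96, 165]), (313, [173]), (314, [25]), (320, [165]), (322, [156, 167, 182]), (332,
     [364]), (333, [165]), (336, [29, 258, 308]), (341, [96]), (342, [302]), (349, [91]), (362, [165]), (364, [154,
     228, 332]), (383, [87]), (384, [91])] (Delay link_table_13)) [(6, [18, 53, 62, 127, 146, 148, 215, 267, 314]),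
     (17, [62, 64, 158, 267, 269, 271, 357]), (31, [128]), (69, [236, 251]), (136, [269]), (148, [111]), (163,
     [45]), (166, [54]), (172, [54]), (203, [111]), (240, [74]), (243, [151]), (260, [151]), (269, [135, 266]),
     (323, [18, 53, 314]), (339, [118]), (344, [128]), (380, [221])] (Node (Delay link_table_14) [(13, [64, 357]),
     (33, [152, 354]), (38, [166, 172]), (50, [251]), (92, [24, 45]), (100, [269]), (225, [149]), (257, [158]),
     (326, [240]), (366, [45])] (Delay link_table_15))))"

fun branch :: "letter \<Rightarrow> int \<times> int \<times> int \<times> int \<Rightarrow> int" where
  "branch UU (a, b, c, d) = a"
| "branch UL (a, b, c, d) = b"
| "branch LU (a, b, c, d) = c"
| "branch LL (a, b, c, d) = d"

definition delta :: "int \<Rightarrow> letter \<Rightarrow> int" where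
  "delta q c = (case entry tape_automaton q of None \<Rightarrow> 0 | Some row \<Rightarrow> branch c row)"

definition partners :: "int \<Rightarrow> int \<Rightarrow> int list" where
  "partners j q = (case entry link_table j of None \<Rightarrow> [] | Some xs \<Rightarrow>
     (case map_of xs q of None \<Rightarrow> [] | Some ps \<Rightarrow> ps))"

fun live_subset :: "int list \<Rightarrow> int list \<Rightarrow> bool" where
  "live_subset [] ys = True"
| "live_subset (x # xs) ys = (if x = 0 then False else if x \<in> set ys then live_subset xs ys else False)"

text \<open>
  With the reading head in state \<open>q\<close> and the writing head in any state of \<open>ps\<close>, the transducer
  can only reach a \<open>Move\<close> whose outcome is again listed. Conditionals replace conjunctions so that the
  simplifier evaluates them lazily.
\<close>
fun walk :: "tree \<Rightarrow> int \<Rightarrow> int list \<Rightarrow> bool" where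
  "walk Stop q ps = (q = 0)"
| "walk (Move c j) q ps =
    (if q = 0 then True else live_subset (map (\<lambda>p. delta p c) ps) (partners j q))"
| "walk (Read t1 t2 t3 t4) q ps =
    (if q = 0 then True else (case entry tape_automaton q of None \<Rightarrow> False
     | Some (a, b, c, d) \<Rightarrow>
        if walk t1 a ps then if walk t2 b ps then if walk t3 c ps then walk t4 d ps
        else False else False else False))"

definition links_closed :: "int \<Rightarrow> bool" where
  "links_closed j = (case entry view_table j of None \<Rightarrow> True | Some (s, t) \<Rightarrow>
     (case entry link_table j of None \<Rightarrow> True | Some xs \<Rightarrow> list_all (\<lambda>(q, ps). walk t q ps) xs))"

text \<open>Crude bounds from which it follows that there are infinitely many lower queens.\<close>
fun moderate :: "state \<Rightarrow> bool" where
  "moderate (State m D R A Y h e) \<longleftrightarrow> - 20 \<le> e \<and> e \<le> h + m + 20"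

text \<open>
  As \<open>n = r + uppers_below r - e\<close>, the reading head is behind the writing head when
  \<open>e < uppers_below r\<close>. From \<open>r = 20\<close> on there are 12 upper columns below \<open>r\<close>.
\<close>
fun behind :: "state \<Rightarrow> bool" where
  "behind (State m D R A Y h e) \<longleftrightarrow> e < 12"

fun tree_ok :: "state \<Rightarrow> tree \<Rightarrow> bool" where
  "tree_ok s Stop = True"
| "tree_ok s (Move c j) = (case entry view_table j of None \<Rightarrow> False
     | Some (s', _) \<Rightarrow> 1 \<le> j \<and> j \<le> 160 \<and> step s = Some (c, s'))"
| "tree_ok s (Read t1 t2 t3 t4) = (behind s \<and> tree_ok (read UU s) t1 \<and> tree_ok (read UL s) t2
      \<and> tree_ok (read LU s) t3 \<and> tree_ok (read LL s) t4)"

definition view_ok :: "int \<Rightarrow> bool" where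
  "view_ok j = (case entry view_table j of None \<Rightarrow> True | Some (s, t) \<Rightarrow> moderate s \<and> tree_ok s t)"

lemma views_checked: "list_all view_ok [1..160]"
  by code_simp

lemma links_checked: "list_all links_closed [1..160]"
  by code_simp

section \<open>The first thirty columns\<close>

text \<open>
  The induction starts at column 30, where the lowest free row is 19 and the letters before position 20
  have been read. There the reading head is far enough behind the writing head. The columns before
  it are computed by the rule of \<open>greedy_choice\<close>.
\<close>
definition clear :: "(int \<times> int) list \<Rightarrow> int \<Rightarrow> int \<Rightarrow> bool" where
  "clear qs n y = list_all (\<lambda>(i, q). y \<noteq> q \<and> y - n \<noteq> q - i \<and> y + n \<noteq> q + i) qs"

primrec greedy :: "nat \<Rightarrow> (int \<times> int) list" where
  "greedy 0 = [(0, 0)]"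
| "greedy (Suc k) = (let qs = greedy k; n = int k + 1 in
     qs @ [(n, case find (clear qs n) [0..k] of Some y \<Rightarrow> y
                | None \<Rightarrow> n + 1 + int (length (filter (\<lambda>(i, q). i < q) qs)))])"

lemma greedy_eq: "greedy k = map (\<lambda>i. (int i, int (queen i))) [0..<Suc k]"
proof (induction k)
  case (Suc k)
  define qs where "qs = map (\<lambda>i. (int i, int (queen i))) [0..<Suc k]"
  have clear: "clear qs (int k + 1) (int y) \<longleftrightarrow> free_square (Suc k) y" for y
  proof -
    have eq: "(int y \<noteq> int q \<and> int y - (int k + 1) \<noteq> int q - int i \<and> int y + (int k + 1) \<noteq> int q + int i) \<longleftrightarrow>
      (y \<noteq> q \<and> int y - int (Suc k) \<noteq> int q - int i \<and> y + Suc k \<noteq> q + i)" for q i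
      by auto
    have "clear qs (int k + 1) (int y) \<longleftrightarrow> (\<forall>i<Suc k. int y \<noteq> int (queen i)
        \<and> int y - (int k + 1) \<noteq> int (queen i) - int i \<and> int y + (int k + 1) \<noteq> int (queen i) + int i)"
      unfolding clear_def qs_def list_all_iff set_map set_upt by auto
    then show ?thesis unfolding free_square_def by (simp only: eq)
  qed
  have "(case find (clear qs (int k + 1)) [0..int k] of Some y \<Rightarrow> y
      | None \<Rightarrow> (int k + 1) + 1 + int (length (filter (\<lambda>(i, q). i < q) qs))) = int (queen (Suc k))"
  proof (cases "find (clear qs (int k + 1)) [0..int k]")
    case None
    then have "\<not> free_square (Suc k) y" if "y < Suc k" for y
      using that clear[of y] by (auto simp: find_None_iff)
    moreover have "length (filter (\<lambda>(i, q). i < q) qs) = uppers_below (Suc k)"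
    proof -
      have "filter (\<lambda>(i, q). i < q) qs = map (\<lambda>i. (int i, int (queen i))) (filter upper [0..<Suc k])"
        unfolding qs_def by (simp add: filter_map o_def upper_def[abs_def] del: upt_Suc)
      then have "length (filter (\<lambda>(i, q). i < q) qs) = card (set (filter upper [0..<Suc k]))"
        by (simp only: length_map distinct_card distinct_filter distinct_upt)
      also have "set (filter upper [0..<Suc k]) = {i. i < Suc k \<and> upper i}"
        by (auto simp del: upt_Suc)
      finally show ?thesis by (simp add: uppers_below_def)
    qed
    ultimately show ?thesis
      using None greedy_choice[of "Suc k"] by auto
  next
    case (Some y)
    from Some obtain l where l: "l < length [0..int k]" "y = [0..int k] ! l" "clear qs (int k + 1) y"
        "\<forall>i<l. \<not> clear qs (int k + 1) ([0..int k] ! i)"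
      by (auto simp: find_Some_iff)
    then have y: "y = int l" "l < Suc k" by auto
    then have fr: "free_square (Suc k) l" using clear[of l] l(3) by simp
    then have low: "lower (Suc k)" using lower_iff_free[of "Suc k"] y by auto
    have "queen (Suc k) \<le> l" by (rule queen_le_free[OF _ fr]) simp
    moreover have "\<not> queen (Suc k) < l"
    proof
      assume "queen (Suc k) < l"
      then have "\<not> clear qs (int k + 1) (int (queen (Suc k)))" using l(1,4) by auto
      then show False using clear queen_free[of "Suc k"] by simp
    qed
    ultimately show ?thesis using Some y by simp
  qed
  moreover have "greedy k = qs" using Suc by (simp only: qs_def)
  moreover have "map (\<lambda>i. (int i, int (queen i))) [0..<Suc (Suc k)]
      = qs @ [(int k + 1, int (queen (Suc k)))]"
    by (simp add: qs_def)
  ultimately show ?case by (simp only: greedy.simps Let_def)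
qed simp

lemma greedy_29: "greedy 29 = [(0, 0), (1, 2), (2, 4), (3, 1), (4, 3), (5, 8), (6, 10), (7, 12), (8, 14), (9, 5),
   (10, 7), (11, 18), (12, 6), (13, 21), (14, 9), (15, 24), (16, 26), (17, 28), (18, 30), (19, 11),
   (20, 13), (21, 34), (22, 36), (23, 38), (24, 40), (25, 15), (26, 17), (27, 44), (28, 16), (29, 47)]"
  by code_simp

lemma queen_values:
  "map queen [0..<30] = [0, 2, 4, 1, 3, 8, 10, 12, 14, 5, 7, 18, 6, 21, 9, 24, 26, 28, 30, 11,
     13, 34, 36, 38, 40, 15, 17, 44, 16, 47]"
proof -
  have "map queen [0..<30] = map (nat \<circ> snd) (greedy 29)"
    unfolding greedy_eq by simp
  then show ?thesis unfolding greedy_29 by simp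
qed

lemma upt_30: "[0..<30] = [0, 1, 2, 3, 4, 5, 6, 7, 8, 9, 10, 11, 12, 13, 14, 15, 16, 17, 18, 19,
    20, 21, 22, 23, 24, 25, 26, 27, 28, 29]"
  by (simp add: upt_rec)

lemma queens_30:
  "queen (Suc 0) = 2" "queen 2 = 4" "queen 3 = 1" "queen 4 = 3" "queen 5 = 8" "queen 6 = 10"
  "queen 7 = 12" "queen 8 = 14" "queen 9 = 5" "queen 10 = 7" "queen 11 = 18" "queen 12 = 6"
  "queen 13 = 21" "queen 14 = 9" "queen 15 = 24" "queen 16 = 26" "queen 17 = 28" "queen 18 = 30"
  "queen 19 = 11" "queen 20 = 13" "queen 21 = 34" "queen 22 = 36" "queen 23 = 38" "queen 24 = 40"
  "queen 25 = 15" "queen 26 = 17" "queen 27 = 44" "queen 28 = 16" "queen 29 = 47"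
  using queen_values unfolding upt_30 by simp_all

lemma lowers_30: "{k. k < 30 \<and> lower k} = {3, 4, 9, 10, 12, 14, 19, 20, 25, 26, 28}"
proof -
  have "{k. k < 30 \<and> lower k} = set (filter lower [0..<30])" by auto
  then show ?thesis unfolding upt_30 by (simp add: lower_def queens_30)
qed

lemma uppers_30: "{k. k < 30 \<and> upper k} =
  {1, 2, 5, 6, 7, 8, 11, 13, 15, 16, 17, 18, 21, 22, 23, 24, 27, 29}"
proof -
  have "{k. k < 30 \<and> upper k} = set (filter upper [0..<30])" by auto
  then show ?thesis unfolding upt_30 by (simp add: upper_def queens_30)
qed

lemma below_30: "(m::nat) \<le> 30 \<Longrightarrow> {k. k < m \<and> P k} = {k \<in> {k. k < 30 \<and> P k}. k < m}"
  by auto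

lemma early_bound:
  assumes "lower n" "n < 30"
  shows "\<bar>int n - int (queen n) - (int (lowers_below n) + 1)\<bar> \<le> 4"
proof -
  have "n \<in> {3, 4, 9, 10, 12, 14, 19, 20, 25, 26, 28}"
    using assms lowers_30 by blast
  moreover have "lowers_below n = length (filter (\<lambda>k. k < n) [3, 4, 9, 10, 12, 14, 19, 20, 25, 26, 28])"
  proof -
    have "{k. k < n \<and> lower k} = set (filter (\<lambda>k. k < n) [3, 4, 9, 10, 12, 14, 19, 20, 25, 26, 28])"
      unfolding below_30[OF less_imp_le[OF assms(2)], of lower] lowers_30
      by (simp only: set_filter list.set)
    then show ?thesis unfolding lowers_below_def by (simp only: distinct_card distinct_filter) (simp add: distinct_card)
  qed
  ultimately show ?thesis
    by (elim insertE emptyE) (simp_all add: queens_30)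
qed

text \<open>An upper queen in a row below 30 stands in a column below 30.\<close>
lemma upper_row_30: "z < 30 \<Longrightarrow> int z \<in> upper_rows \<longleftrightarrow>
    z \<in> {2, 4, 8, 10, 12, 14, 18, 21, 24, 26, 28, 30, 34, 36, 38, 40, 44, 47}"
proof -
  assume z: "z < 30"
  have "int z \<in> upper_rows \<longleftrightarrow> z \<in> queen ` {k. k < 30 \<and> upper k}"
    using z by (auto simp: upper_rows_def upper_def)
  also have "\<dots> \<longleftrightarrow> z \<in> {2, 4, 8, 10, 12, 14, 18, 21, 24, 26, 28, 30, 34, 36, 38, 40, 44, 47}"
    unfolding uppers_30 by (simp add: queens_30)
  finally show ?thesis .
qed

lemma uppers_20: "{k. k < 20 \<and> upper k} = {1, 2, 5, 6, 7, 8, 11, 13, 15, 16, 17, 18}"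
proof -
  have le: "(20::nat) \<le> 30" by simp
  have "{k. k < 20 \<and> upper k} = set (filter (\<lambda>k. k < 20) [1, 2, 5, 6, 7, 8, 11, 13, 15, 16, 17, 18, 21, 22, 23, 24, 27, 29])"
    unfolding below_30[OF le, of upper] uppers_30
    by (simp only: set_filter list.set)
  then show ?thesis by simp
qed

lemma uppers_below_20: "uppers_below 20 = 12"
  by (simp add: uppers_below_def uppers_20)

lemma view_30: "view_at 30 19 20 (State 0 [1] [] [] [0] 1 2)"
proof -
  have rows: "lower_rows 30 = {1, 3, 5, 6, 7, 9, 11, 13, 15, 16, 17}"
    and diags: "lower_diags 30 = {1, 2, 3, 4, 5, 6, 7, 8, 9, 10, 12}"
    and antis: "lower_antis 30 = {4, 7, 14, 17, 18, 23, 30, 33, 40, 43, 44}"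
  proof -
    have "lower_rows 30 = (\<lambda>k. int (queen k)) ` {k. k < 30 \<and> lower k}"
      "lower_diags 30 = (\<lambda>k. int k - int (queen k)) ` {k. k < 30 \<and> lower k}"
      "lower_antis 30 = (\<lambda>k. int k + int (queen k)) ` {k. k < 30 \<and> lower k}"
      by (auto simp: lower_rows_def lower_diags_def lower_antis_def)
    then show "lower_rows 30 = {1, 3, 5, 6, 7, 9, 11, 13, 15, 16, 17}"
      "lower_diags 30 = {1, 2, 3, 4, 5, 6, 7, 8, 9, 10, 12}"
      "lower_antis 30 = {4, 7, 14, 17, 18, 23, 30, 33, 40, 43, 44}"
      unfolding lowers_30 by (auto simp: queens_30)
  qed
  have up20: "k < 20 \<and> upper k \<longleftrightarrow> k \<in> {1, 2, 5, 6, 7, 8, 11, 13, 15, 16, 17, 18}" for k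
    using uppers_20 by blast
  have ex: "(\<exists>k<20. upper k \<and> P k) \<longleftrightarrow> (\<exists>k\<in>{1, 2, 5, 6, 7, 8, 11, 13, 15, 16, 17, 18}. P k)" for P
    using up20 by blast
  show ?thesis
  proof (rule view.intro, unfold state.sel ex)
    fix y :: int assume y: "0 < y" "y < 19"
    then have "y \<in> {1..18}" by simp
    also have "{1..18::int} = set [1..18]" by simp
    also have "[1..18::int] = [1, 2, 3, 4, 5, 6, 7, 8, 9, 10, 11, 12, 13, 14, 15, 16, 17, 18]"
      by code_simp
    finally show "y \<in> upper_rows \<union> lower_rows 30"
      using upper_row_30[of "nat y"] y unfolding rows by auto
  next
    fix d :: int assume d: "0 < d" "d < int 30 - 19 + 0"
    then have "d \<in> {1..10}" by simp
    also have "{1..10::int} = set [1..10]" by simp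
    also have "[1..10::int] = [1, 2, 3, 4, 5, 6, 7, 8, 9, 10]" by code_simp
    finally show "d \<in> lower_diags 30" unfolding diags by auto
  next
    fix i :: int
    show "i \<in> set [] \<longleftrightarrow> 0 \<le> i \<and> (19 + i \<in> lower_rows 30 \<or> i < 1 \<and> 19 + i \<in> upper_rows)"
      using upper_row_30[of 19] unfolding rows by (cases "i = 0") auto
    show "i \<in> set [] \<longleftrightarrow> 0 \<le> i \<and> (int 30 + 19 + i \<in> lower_antis 30 \<or>
      (\<exists>k\<in>{1, 2, 5, 6, 7, 8, 11, 13, 15, 16, 17, 18}. int 30 + 19 + i = int k + int (queen k)))"
      unfolding antis by (auto simp: queens_30)
    show "i \<in> set [0] \<longleftrightarrow> 0 \<le> i \<and>
      (\<exists>k\<in>{1, 2, 5, 6, 7, 8, 11, 13, 15, 16, 17, 18}. int 30 + i = int (queen k))"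
      by (auto simp: queens_30)
    show "i \<in> set [1] \<longleftrightarrow> 0 \<le> i \<and> int 30 - 19 + 0 + i \<in> lower_diags 30"
      unfolding diags by auto
  qed (simp_all add: uppers_below_20)
qed

section \<open>The transducer follows the queens\<close>

text \<open>The state of the automaton after the letters from position 20 up to \<open>n - 1\<close>; 0 means failure.\<close>
definition run :: "nat \<Rightarrow> int" where
  "run n = fold (\<lambda>c q. delta q c) (map letter [20..<n]) 1"

lemma run_Suc: "20 \<le> n \<Longrightarrow> run (Suc n) = delta (run n) (letter n)"
  by (simp add: run_def)

lemma delta_dead [simp]: "delta 0 c = 0"
  by (simp add: delta_def entry_def)

lemma run_alive: "run n \<noteq> 0 \<Longrightarrow> 20 \<le> i \<Longrightarrow> i \<le> n \<Longrightarrow> run i \<noteq> 0"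
proof (induction n)
  case (Suc n)
  show ?case
  proof (cases "i = Suc n")
    case False
    then have "run n \<noteq> 0" using Suc.prems by (auto simp: run_Suc)
    with False Suc show ?thesis by simp
  qed (use Suc in simp)
qed simp

lemma live_subset_iff: "live_subset xs ys \<longleftrightarrow> (\<forall>x\<in>set xs. x \<noteq> 0 \<and> x \<in> set ys)"
  by (induction xs) auto

lemma partnersE:
  assumes "p \<in> set (partners j q)"
  obtains xs ps where "entry link_table j = Some xs" "map_of xs q = Some ps" "p \<in> set ps"
proof (cases "entry link_table j")
  case (Some xs)
  with assms that show ?thesis by (cases "map_of xs q") (auto simp: partners_def)
qed (use assms in \<open>simp add: partners_def\<close>)

lemma run_30: "run 30 = 23"
proof -
  have "map letter [20..<30] = [LL, UU, UL, UL, UU, LL, LU, UL, LU, UL]"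
    by (simp add: upt_rec_numeral letter_def upper_def queens_30 upper_row_30[of 20, simplified] upper_row_30[of 21, simplified]
      upper_row_30[of 22, simplified] upper_row_30[of 23, simplified] upper_row_30[of 24, simplified]
      upper_row_30[of 25, simplified] upper_row_30[of 26, simplified] upper_row_30[of 27, simplified]
      upper_row_30[of 28, simplified] upper_row_30[of 29, simplified])
  then have "run 30 = fold (\<lambda>c q. delta q c) [LL, UU, UL, UL, UU, LL, LU, UL, LU, UL] 1"
    by (simp add: run_def)
  also have "\<dots> = 23" by code_simp
  finally show ?thesis .
qed

lemma run_20: "run 20 = 1"
  by (simp add: run_def)

lemma start_entry: "map_option fst (entry view_table 1) = Some (State 0 [1] [] [] [0] 1 2)"
  by code_simp

lemma start_pair: "23 \<in> set (partners 1 1)"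
  by code_simp

text \<open>
  The induction hypothesis: some memory state \<open>j\<close> of the table describes column \<open>n\<close> after the letters before
  \<open>r\<close> have been read, and the automaton states at \<open>r\<close> and at \<open>n\<close> are listed for it. That \<open>run n\<close> is
  alive says that the whole tape written so far is accepted.
\<close>
definition linked :: "nat \<Rightarrow> nat \<Rightarrow> int \<Rightarrow> bool" where
  "linked n r j \<longleftrightarrow> 1 \<le> j \<and> j \<le> 160 \<and> 20 \<le> r \<and> r \<le> n \<and> run n \<noteq> 0
     \<and> run n \<in> set (partners j (run r))
     \<and> (\<exists>a s t. entry view_table j = Some (s, t) \<and> view_at n a r s)"

lemma linked_30: "linked 30 20 1"
  unfolding linked_def using start_entry start_pair view_30 by (auto simp: run_30 run_20)

text \<open>
  Before each letter is read, \<open>behind\<close> guarantees that it has been written. So the automaton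
  accepts it, for the run up to \<open>n\<close> is alive, and the tree has a branch for it.
\<close>
lemma walk_sound:
  assumes "view_at n a r s" "tree_ok s t" "walk t (run r) ps"
    and "20 \<le> r" "r \<le> n" "run n \<noteq> 0" "run n \<in> set ps"
  shows "(\<exists>r' j. linked (Suc n) r' j)
    \<and> (lower n \<longrightarrow> \<bar>int n - int (queen n) - (int (lowers_below n) + 1)\<bar> \<le> 4)"
  using assms
proof (induction t arbitrary: s r)
  case Stop
  then show ?case using run_alive[of n r] by simp
next
  case (Move c j)
  obtain s' t' where j: "entry view_table j = Some (s', t')" "1 \<le> j" "j \<le> 160" and st: "step s = Some (c, s')"
    using Move.prems(2) by (auto split: option.splits)
  have n: "0 < n" using Move.prems by simp
  note S = step_sound[OF n Move.prems(1) st]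
  have q: "run r \<noteq> 0" using run_alive[of n r] Move.prems by simp
  have run: "run (Suc n) = delta (run n) c"
    using run_Suc[of n] Move.prems(4,5) S(1) by simp
  have "delta (run n) c \<noteq> 0" "delta (run n) c \<in> set (partners j (run r))"
    using Move.prems(3,7) q by (auto simp: live_subset_iff split: if_splits)
  then have "linked (Suc n) r j"
    unfolding linked_def run using j S(2) Move.prems(4,5) by auto
  then show ?case using S(3) by blast
next
  case (Read t1 t2 t3 t4)
  obtain m D R A Y h e where s: "s = State m D R A Y h e" by (cases s)
  have e: "e = int r + int (uppers_below r) - int n"
    using Read.prems(1) unfolding s view_def by simp
  have "e < 12" using Read.prems(2) s by simp
  moreover have "12 \<le> uppers_below r"
    using uppers_below_mono[OF Read.prems(4)] by (simp add: uppers_below_20)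
  ultimately have "r < n" using e by linarith
  have q: "run r \<noteq> 0" using run_alive[of n r] Read.prems by simp
  have next_q: "run (Suc r) = delta (run r) (letter r)"
    using run_Suc Read.prems(4) by blast
  obtain x1 x2 x3 x4 where row: "entry tape_automaton (run r) = Some (x1, x2, x3, x4)"
    and w: "walk t1 x1 ps" "walk t2 x2 ps" "walk t3 x3 ps" "walk t4 x4 ps"
    using Read.prems(3) q by (auto split: option.splits if_splits)
  have prems: "20 \<le> Suc r" "Suc r \<le> n" using \<open>r < n\<close> Read.prems(4) by auto
  note V = read_sound[OF Read.prems(1)]
  show ?case
  proof (cases "letter r")
    case UU
    then have "run (Suc r) = x1" using next_q row by (simp add: delta_def)
    then show ?thesis
      using Read.IH(1)[of "Suc r" "read UU s"] V UU w(1) Read.prems(2,6,7) prems by simp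
  next
    case UL
    then have "run (Suc r) = x2" using next_q row by (simp add: delta_def)
    then show ?thesis
      using Read.IH(2)[of "Suc r" "read UL s"] V UL w(2) Read.prems(2,6,7) prems by simp
  next
    case LU
    then have "run (Suc r) = x3" using next_q row by (simp add: delta_def)
    then show ?thesis
      using Read.IH(3)[of "Suc r" "read LU s"] V LU w(3) Read.prems(2,6,7) prems by simp
  next
    case LL
    then have "run (Suc r) = x4" using next_q row by (simp add: delta_def)
    then show ?thesis
      using Read.IH(4)[of "Suc r" "read LL s"] V LL w(4) Read.prems(2,6,7) prems by simp
  qed
qed

lemma linked_step:
  assumes "linked n r j"
  shows "\<exists>r' j'. linked (Suc n) r' j'"
    and "lower n \<Longrightarrow> \<bar>int n - int (queen n) - (int (lowers_below n) + 1)\<bar> \<le> 4"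
proof -
  obtain a s t where m: "entry view_table j = Some (s, t)" and V: "view_at n a r s"
    using assms by (auto simp: linked_def)
  have j: "j \<in> set [1..160]" using assms by (simp add: linked_def)
  have "view_ok j" "links_closed j"
    using j views_checked links_checked unfolding list_all_iff by blast+
  then have t: "tree_ok s t" using m by (simp add: view_ok_def)
  obtain xs ps where xs: "entry link_table j = Some xs" "map_of xs (run r) = Some ps"
    and p: "run n \<in> set ps"
    using assms by (auto simp: linked_def elim: partnersE)
  have "walk t (run r) ps"
    using \<open>links_closed j\<close> m xs(1) map_of_SomeD[OF xs(2)] by (auto simp: links_closed_def list_all_iff)
  from walk_sound[OF V t this _ _ _ p] assms
  show "\<exists>r' j'. linked (Suc n) r' j'" "lower n \<Longrightarrow> \<bar>int n - int (queen n) - (int (lowers_below n) + 1)\<bar> \<le> 4"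
    by (auto simp: linked_def)
qed

lemma linked_all: "30 \<le> n \<Longrightarrow> \<exists>r j. linked n r j"
proof (induction n rule: dec_induct)
  case base
  show ?case using linked_30 by blast
next
  case (step n)
  then show ?case using linked_step(1) by blast
qed

section \<open>From diagonals to their numbering\<close>

lemma columns_le_lowers_plus_uppers: "n \<le> lowers_below n + uppers_below n + 1"
proof -
  have "{..<n} \<subseteq> insert 0 ({k. k < n \<and> lower k} \<union> {k. k < n \<and> upper k})"
    using upper_iff_not_lower by auto
  then have "card {..<n} \<le> card (insert 0 ({k. k < n \<and> lower k} \<union> {k. k < n \<and> upper k}))"
    by (intro card_mono) auto
  also have "\<dots> \<le> Suc (card ({k. k < n \<and> lower k} \<union> {k. k < n \<and> upper k}))"
    by (rule card_insert_le_m1[THEN order_trans]) (auto simp: card_insert_if)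
  also have "\<dots> \<le> Suc (lowers_below n + uppers_below n)"
    unfolding lowers_below_def uppers_below_def using card_Un_le by simp
  finally show ?thesis by simp
qed

text \<open>
  By \<open>lowers_below_view\<close> and the bounds in \<open>moderate\<close>, the number of lower columns before \<open>n\<close> keeps up with
  the number of upper columns before the reading head \<open>r\<close>, and \<open>r\<close> grows with \<open>n\<close>. If there were only finitely
  many lower columns, almost all columns before \<open>r\<close> would be upper.
\<close>
lemma infinite_lower: "infinite {n. lower n}"
proof
  assume fin: "finite {n. lower n}"
  define c where "c = card {n. lower n}"
  have c: "lowers_below n \<le> c" for n
    unfolding lowers_below_def c_def by (rule card_mono[OF fin]) auto
  define n where "n = 4 * c + 200"
  obtain r j where L: "linked n r j" using linked_all[of n] by (auto simp: n_def)
  then obtain a s t where m: "entry view_table j = Some (s, t)" and V: "view_at n a r s"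
    by (auto simp: linked_def)
  obtain m D R A Y h e where s: "s = State m D R A Y h e" by (cases s)
  have "view_ok j"
    using L views_checked by (auto simp: linked_def list_all_iff)
  then have moderate: "- 20 \<le> e" "e \<le> h + m + 20"
    using m s by (auto simp: view_ok_def)
  have e: "e = int r + int (uppers_below r) - int n" and h: "h = int r - a"
    using V unfolding s view_def by simp_all
  have low: "int (lowers_below n) = int n - a + m - 1 + int (length D)"
    using lowers_below_view V s by blast
  have "int (uppers_below r) \<le> int c + 21"
    using low e h moderate(2) c[of n] by linarith
  moreover have "int r \<le> int c + int (uppers_below r) + 1"
    using columns_le_lowers_plus_uppers[of r] c[of r] by linarith
  ultimately have "int n \<le> 3 * int c + 100" using e moderate(1) by linarith
  then show False by (simp add: n_def)
qed

lemma lower_bound_all: "lower n \<Longrightarrow> \<bar>int n - int (queen n) - (int (lowers_below n) + 1)\<bar> \<le> 4"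
  using early_bound linked_all linked_step(2) by (meson not_le)

lemma card_below_enumerate:
  fixes S :: "nat set"
  assumes "infinite S"
  shows "card {k. k < enumerate S i \<and> k \<in> S} = i"
proof -
  have "{k. k < enumerate S i \<and> k \<in> S} = enumerate S ` {..<i}"
  proof (intro set_eqI iffI)
    fix k assume "k \<in> {k. k < enumerate S i \<and> k \<in> S}"
    then obtain l where "k = enumerate S l" "enumerate S l < enumerate S i"
      using enumerate_Ex[OF assms, of k] by auto
    then show "k \<in> enumerate S ` {..<i}"
      using enumerate_mono[OF _ assms, of i l] by (cases l i rule: linorder_cases) auto
  qed (use assms in \<open>auto simp: enumerate_in_set enumerate_mono\<close>)
  then show ?thesis
    using assms by (simp add: card_image inj_enumerate inj_on_subset[OF _ subset_UNIV])
qed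

theorem lemma5:
  fixes j :: nat
  assumes "1 \<le> j"
  shows "\<bar>lower_diag j - int j\<bar> \<le> 4"
proof -
  have lc: "lower_columns = {n. lower n}" by (simp add: lower_columns_def lower_def)
  define x where "x = lower_x j"
  have "lower x"
    using enumerate_in_set[OF infinite_lower, of "j - 1"] by (simp add: x_def lower_x_def lc)
  moreover have "lowers_below x = j - 1"
    using card_below_enumerate[OF infinite_lower, of "j - 1"] by (simp add: x_def lower_x_def lc lowers_below_def)
  ultimately have "\<bar>int x - int (queen x) - int j\<bar> \<le> 4"
    using lower_bound_all[of x] assms by simp
  then show ?thesis by (simp add: lower_diag_def lower_y_def x_def)
qed

end
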